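(* Let $\pi:E\to X$ be a C*-bundle. Any compatible completion for $\pi$ is $*$-isomorphic to $C_0(X,E)$, and it is localizable.
   Context: A Banach bundle over a Hausdorff space $X$ is a continuous open surjection $\pi:E\to X$ with $E$ Hausdorff and complex Banach space fibres $E_x=\pi^{-1}(\{x\})$ such that: addition $E\times_XE\to E$ and scalar multiplication by each $\lambda\in\mathbb C$ are continuous; $e\mapsto\|e\|$ is upper semicontinuous; for each $x$ and open $V\ni 0_x$ there are $\varepsilon>0$ and an open $U\ni x$ with $\{e\in\pi^{-1}(U):\|e\|<\varepsilon\}\subset V$. A C*-bundle is a Fell bundle on a locally compact Hausdorff space $X$ (regarded as a groupoid all of whose arrows are units), i.e. a Banach bundle $\pi:E\to X$ whose fibres are C*-algebras, with multiplication $E\times_XE\to E$ and involution $E\to E$ continuous. $C_0(X,E)$ is the C*-algebra of continuous sections of $\pi$ vanishing at infinity, with pointwise operations and supremum norm. For open $U\subset X$, $C_c(U,E)$ is the space of continuous sections with compact support contained in $U$; the convolution algebra is the $*$-algebra $C_c(X,E)$ with pointwise operations. All open subsets of $X$ are local bisections, so a compatible norm is a C*-norm on $C_c(X,E)$ satisfying $\|s\|_\infty\le\|s\|$ for all $s$, and $\|s\|=\|s\|_\infty$ whenever $s\in C_c(U,E)$ for some open $U\subset X$, where $\|s\|_\infty=\sup_x\|s(x)\|$. The C*-completion $A$ of $C_c(X,E)$ in such a norm is a compatible completion for $\pi$. For $x\in X$, $s\mapsto s(x)$ extends to a continuous linear map $\operatorname{eval}_x:A\to E_x$. For open $V\subset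 X$ let $p^*(V)$ be the closed linear span in $A$ of $\bigcup\{C_c(U,E): U\subset V\text{ open}\}$ (that is, the closure of $C_c(V,E)$). For $a\in A$ let $\sigma(\langle a\rangle)=\operatorname{int}\{x\in X:\operatorname{eval}_x(a)\neq0\}$ and for open $V$ let $\gamma(V)=\overline{\operatorname{span}}\{a\in A:\sigma(\langle a\rangle)\subset V\}$. $A$ is localizable if $p^*(V)=\gamma(V)$ for all open $V\subset X$. *)

theory Defs
  imports
    "HOL-Analysis.Analysis"
    "HOL-Algebra.Module"
    "HOL-Algebra.Algebraic_Closure_Type"
begin

section \<open>Normed *-algebras and C*-algebras\<close>

text \<open>
  The algebras here need not be unital: the field \<open>one\<close> inherited from the ring record carries
  no meaning and no axiom below mentions it.  All axioms are relative to the carrier.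
\<close>

abbreviation complex_field :: "complex ring"
  where "complex_field \<equiv> ring_of_type_algebra"

record 'a star_alg = "(complex, 'a) module" +
  star :: "'a \<Rightarrow> 'a"

record 'a normed_star_alg = "'a star_alg" +
  nrm :: "'a \<Rightarrow> real"

locale star_algebra = Module.module complex_field A
  for A :: "('a, 'm) star_alg_scheme" (structure) +
  assumes mult_closed: "\<lbrakk>a \<in> carrier A; b \<in> carrier A\<rbrakk> \<Longrightarrow> a \<otimes> b \<in> carrier A"
    and mult_assoc: "\<lbrakk>a \<in> carrier A; b \<in> carrier A; c \<in> carrier A\<rbrakk> \<Longrightarrow>
      (a \<otimes> b) \<otimes> c = a \<otimes> (b \<otimes> c)"
    and mult_add_left: "\<lbrakk>a \<in> carrier A; b \<in> carrier A; c \<in> carrier A\<rbrakk> \<Longrightarrow>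
      (a \<oplus> b) \<otimes> c = (a \<otimes> c) \<oplus> (b \<otimes> c)"
    and mult_add_right: "\<lbrakk>a \<in> carrier A; b \<in> carrier A; c \<in> carrier A\<rbrakk> \<Longrightarrow>
      a \<otimes> (b \<oplus> c) = (a \<otimes> b) \<oplus> (a \<otimes> c)"
    and mult_smult_left: "\<lbrakk>a \<in> carrier A; b \<in> carrier A\<rbrakk> \<Longrightarrow>
      (z \<odot> a) \<otimes> b = z \<odot> (a \<otimes> b)"
    and mult_smult_right: "\<lbrakk>a \<in> carrier A; b \<in> carrier A\<rbrakk> \<Longrightarrow>
      a \<otimes> (z \<odot> b) = z \<odot> (a \<otimes> b)"
    and star_closed: "a \<in> carrier A \<Longrightarrow> star A a \<in> carrier A"
    and star_star: "a \<in> carrier A \<Longrightarrow> star A (star A a) = a"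
    and star_add: "\<lbrakk>a \<in> carrier A; b \<in> carrier A\<rbrakk> \<Longrightarrow>
      star A (a \<oplus> b) = star A a \<oplus> star A b"
    and star_smult: "a \<in> carrier A \<Longrightarrow> star A (z \<odot> a) = cnj z \<odot> star A a"
    and star_mult: "\<lbrakk>a \<in> carrier A; b \<in> carrier A\<rbrakk> \<Longrightarrow>
      star A (a \<otimes> b) = star A b \<otimes> star A a"

definition vector_norm :: "(complex, 'a, 'm) module_scheme \<Rightarrow> ('a \<Rightarrow> real) \<Rightarrow> bool" where
  "vector_norm A N \<longleftrightarrow>
     (\<forall>a\<in>carrier A. 0 \<le> N a) \<and>
     (\<forall>a\<in>carrier A. N a = 0 \<longleftrightarrow> a = \<zero>\<^bsub>A\<^esub>) \<and>
     (\<forall>z. \<forall>a\<in>carrier A. N (z \<odot>\<^bsub>A\<^esub> a) = cmod z * N a) \<and>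
     (\<forall>a\<in>carrier A. \<forall>b\<in>carrier A. N (a \<oplus>\<^bsub>A\<^esub> b) \<le> N a + N b)"

definition cstar_norm :: "('a, 'm) star_alg_scheme \<Rightarrow> ('a \<Rightarrow> real) \<Rightarrow> bool" where
  "cstar_norm A N \<longleftrightarrow>
     vector_norm A N \<and>
     (\<forall>a\<in>carrier A. \<forall>b\<in>carrier A. N (a \<otimes>\<^bsub>A\<^esub> b) \<le> N a * N b) \<and>
     (\<forall>a\<in>carrier A. N (star A a \<otimes>\<^bsub>A\<^esub> a) = (N a)\<^sup>2)"

text \<open>\<open>Metric_space\<close> requires nonnegativity and symmetry even off the carrier, hence the guard.\<close>

definition norm_dist :: "('a, 'm) normed_star_alg_scheme \<Rightarrow> 'a \<Rightarrow> 'a \<Rightarrow> real" where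
  "norm_dist A a b = (if a \<in> carrier A \<and> b \<in> carrier A then nrm A (a \<ominus>\<^bsub>A\<^esub> b) else 0)"

definition norm_topology :: "('a, 'm) normed_star_alg_scheme \<Rightarrow> 'a topology" where
  "norm_topology A = Metric_space.mtopology (carrier A) (norm_dist A)"

text \<open>
  Only the linear structure and the norm matter for being a Banach space, although the record
  also provides a multiplication and an involution.
\<close>

definition banach_space :: "('a, 'm) normed_star_alg_scheme \<Rightarrow> bool" where
  "banach_space A \<longleftrightarrow>
     Module.module complex_field A \<and> vector_norm A (nrm A) \<and>
     Metric_space.mcomplete (carrier A) (norm_dist A)"

definition cstar_algebra :: "('a, 'm) normed_star_alg_scheme \<Rightarrow> bool" where
  "cstar_algebra A \<longleftrightarrow> star_algebra A \<and> cstar_norm A (nrm A) \<and> banach_space A"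

definition complex_linear ::
  "(complex, 'a, 'm) module_scheme \<Rightarrow> (complex, 'b, 'n) module_scheme \<Rightarrow> ('a \<Rightarrow> 'b) \<Rightarrow> bool" where
  "complex_linear A B f \<longleftrightarrow>
     f \<in> carrier A \<rightarrow> carrier B \<and>
     (\<forall>a\<in>carrier A. \<forall>b\<in>carrier A. f (a \<oplus>\<^bsub>A\<^esub> b) = f a \<oplus>\<^bsub>B\<^esub> f b) \<and>
     (\<forall>z. \<forall>a\<in>carrier A. f (z \<odot>\<^bsub>A\<^esub> a) = z \<odot>\<^bsub>B\<^esub> f a)"

definition star_hom ::
  "('a, 'm) star_alg_scheme \<Rightarrow> ('b, 'n) star_alg_scheme \<Rightarrow> ('a \<Rightarrow> 'b) \<Rightarrow> bool" where
  "star_hom A B f \<longleftrightarrow>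
     complex_linear A B f \<and>
     (\<forall>a\<in>carrier A. \<forall>b\<in>carrier A. f (a \<otimes>\<^bsub>A\<^esub> b) = f a \<otimes>\<^bsub>B\<^esub> f b) \<and>
     (\<forall>a\<in>carrier A. f (star A a) = star B (f a))"

definition star_isomorphic ::
  "('a, 'm) star_alg_scheme \<Rightarrow> ('b, 'n) star_alg_scheme \<Rightarrow> bool" where
  "star_isomorphic A B \<longleftrightarrow> (\<exists>f. star_hom A B f \<and> bij_betw f (carrier A) (carrier B))"

definition closed_span :: "('a, 'm) normed_star_alg_scheme \<Rightarrow> 'a set \<Rightarrow> 'a set" where
  "closed_span A S =
     norm_topology A closure_of ((\<lambda>H. submodule H complex_field A) hull S)"

text \<open>
  A completion of the *-algebra \<open>S\<close> in the norm \<open>N\<close> is a C*-algebra \<open>A\<close> together with the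
  canonical map \<open>j\<close> from \<open>S\<close> to \<open>A\<close>; it is injective because \<open>N\<close> is a norm.
\<close>

definition cstar_completion ::
  "('s, 'n) star_alg_scheme \<Rightarrow> ('s \<Rightarrow> real) \<Rightarrow> ('a, 'm) normed_star_alg_scheme \<Rightarrow> ('s \<Rightarrow> 'a) \<Rightarrow> bool"
  where
  "cstar_completion S N A j \<longleftrightarrow>
     cstar_algebra A \<and> star_hom S A j \<and>
     (\<forall>s\<in>carrier S. nrm A (j s) = N s) \<and>
     norm_topology A closure_of (j ` carrier S) = carrier A"


section \<open>Banach bundles and C*-bundles\<close>

text \<open>
  The operations of a bundle are given fibrewise: \<open>fib B x\<close> is the fibre over \<open>x\<close>,
  with its operations and its norm.
\<close>

record ('x, 'e) fibrewise_bundle =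
  base :: "'x topology"
  total :: "'e topology"
  proj :: "'e \<Rightarrow> 'x"
  fib :: "'x \<Rightarrow> 'e normed_star_alg"

definition fibre_product :: "('x, 'e, 'm) fibrewise_bundle_scheme \<Rightarrow> ('e \<times> 'e) topology" where
  "fibre_product B =
     subtopology (prod_topology (total B) (total B)) {(e, f). proj B e = proj B f}"

definition banach_bundle :: "('x, 'e, 'm) fibrewise_bundle_scheme \<Rightarrow> bool" where
  "banach_bundle B \<longleftrightarrow>
     Hausdorff_space (base B) \<and> Hausdorff_space (total B) \<and>
     continuous_map (total B) (base B) (proj B) \<and>
     open_map (total B) (base B) (proj B) \<and>
     proj B ` topspace (total B) = topspace (base B) \<and>
     (\<forall>x\<in>topspace (base B).
        carrier (fib B x) = {e \<in> topspace (total B). proj B e = x} \<and> banach_space (fib B x)) \<and>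
     continuous_map (fibre_product B) (total B) (\<lambda>(e, f). e \<oplus>\<^bsub>fib B (proj B e)\<^esub> f) \<and>
     (\<forall>z. continuous_map (total B) (total B) (\<lambda>e. z \<odot>\<^bsub>fib B (proj B e)\<^esub> e)) \<and>
     (\<forall>r. openin (total B) {e \<in> topspace (total B). nrm (fib B (proj B e)) e < r}) \<and>
     (\<forall>x\<in>topspace (base B). \<forall>V. openin (total B) V \<and> \<zero>\<^bsub>fib B x\<^esub> \<in> V \<longrightarrow>
        (\<exists>\<epsilon>>0. \<exists>U. openin (base B) U \<and> x \<in> U \<and>
           {e \<in> topspace (total B). proj B e \<in> U \<and> nrm (fib B (proj B e)) e < \<epsilon>} \<subseteq> V))"

definition cstar_bundle :: "('x, 'e, 'm) fibrewise_bundle_scheme \<Rightarrow> bool" where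
  "cstar_bundle B \<longleftrightarrow>
     locally_compact_space (base B) \<and> banach_bundle B \<and>
     (\<forall>x\<in>topspace (base B). cstar_algebra (fib B x)) \<and>
     continuous_map (fibre_product B) (total B) (\<lambda>(e, f). e \<otimes>\<^bsub>fib B (proj B e)\<^esub> f) \<and>
     continuous_map (total B) (total B) (\<lambda>e. star (fib B (proj B e)) e)"


section \<open>Algebras of sections\<close>

text \<open>Sections are \<open>undefined\<close> outside the base space, so that they are determined by their values
  on it.\<close>

definition continuous_sections :: "('x, 'e, 'm) fibrewise_bundle_scheme \<Rightarrow> ('x \<Rightarrow> 'e) set" where
  "continuous_sections B =
     {s \<in> extensional (topspace (base B)).
        continuous_map (base B) (total B) s \<and> (\<forall>x\<in>topspace (base B). proj B (s x) = x)}"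

definition section_support :: "('x, 'e, 'm) fibrewise_bundle_scheme \<Rightarrow> ('x \<Rightarrow> 'e) \<Rightarrow> 'x set" where
  "section_support B s =
     base B closure_of {x \<in> topspace (base B). s x \<noteq> \<zero>\<^bsub>fib B x\<^esub>}"

definition Cc_sections :: "('x, 'e, 'm) fibrewise_bundle_scheme \<Rightarrow> 'x set \<Rightarrow> ('x \<Rightarrow> 'e) set" where
  "Cc_sections B U =
     {s \<in> continuous_sections B. compactin (base B) (section_support B s) \<and> section_support B s \<subseteq> U}"

definition C0_sections :: "('x, 'e, 'm) fibrewise_bundle_scheme \<Rightarrow> ('x \<Rightarrow> 'e) set" where
  "C0_sections B =
     {s \<in> continuous_sections B.
        \<forall>\<epsilon>>0. \<exists>K. compactin (base B) K \<and> (\<forall>x\<in>topspace (base B) - K. nrm (fib B x) (s x) < \<epsilon>)}"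

text \<open>The inserted 0 only matters for the empty base space, where \<open>Sup {}\<close> is unspecified.\<close>

definition sup_norm :: "('x, 'e, 'm) fibrewise_bundle_scheme \<Rightarrow> ('x \<Rightarrow> 'e) \<Rightarrow> real" where
  "sup_norm B s = Sup (insert 0 ((\<lambda>x. nrm (fib B x) (s x)) ` topspace (base B)))"

definition pointwise_algebra ::
  "('x, 'e, 'm) fibrewise_bundle_scheme \<Rightarrow> ('x \<Rightarrow> 'e) set \<Rightarrow> ('x \<Rightarrow> 'e) star_alg" where
  "pointwise_algebra B S =
     \<lparr>carrier = S,
      mult = (\<lambda>s t. \<lambda>x\<in>topspace (base B). s x \<otimes>\<^bsub>fib B x\<^esub> t x),
      one = undefined,
      zero = (\<lambda>x\<in>topspace (base B). \<zero>\<^bsub>fib B x\<^esub>),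
      add = (\<lambda>s t. \<lambda>x\<in>topspace (base B). s x \<oplus>\<^bsub>fib B x\<^esub> t x),
      smult = (\<lambda>z s. \<lambda>x\<in>topspace (base B). z \<odot>\<^bsub>fib B x\<^esub> s x),
      star = (\<lambda>s. \<lambda>x\<in>topspace (base B). star (fib B x) (s x))\<rparr>"

definition convolution_algebra :: "('x, 'e, 'm) fibrewise_bundle_scheme \<Rightarrow> ('x \<Rightarrow> 'e) star_alg" where
  "convolution_algebra B = pointwise_algebra B (Cc_sections B (topspace (base B)))"

definition C0_algebra :: "('x, 'e, 'm) fibrewise_bundle_scheme \<Rightarrow> ('x \<Rightarrow> 'e) normed_star_alg" where
  "C0_algebra B =
     star_alg.extend (pointwise_algebra B (C0_sections B)) (normed_star_alg.fields (sup_norm B))"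


section \<open>Compatible completions and localizability\<close>

definition compatible_norm :: "('x, 'e, 'm) fibrewise_bundle_scheme \<Rightarrow> (('x \<Rightarrow> 'e) \<Rightarrow> real) \<Rightarrow> bool" where
  "compatible_norm B N \<longleftrightarrow>
     cstar_norm (convolution_algebra B) N \<and>
     (\<forall>s\<in>carrier (convolution_algebra B). sup_norm B s \<le> N s) \<and>
     (\<forall>U. openin (base B) U \<longrightarrow> (\<forall>s\<in>Cc_sections B U. N s = sup_norm B s))"

definition compatible_completion ::
  "('x, 'e, 'm) fibrewise_bundle_scheme \<Rightarrow> ('a, 'n) normed_star_alg_scheme \<Rightarrow> (('x \<Rightarrow> 'e) \<Rightarrow> 'a) \<Rightarrow> bool" where
  "compatible_completion B A j \<longleftrightarrow>
     (\<exists>N. compatible_norm B N \<and> cstar_completion (convolution_algebra B) N A j)"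

text \<open>The evaluation at \<open>x\<close> is the unique continuous linear extension to \<open>A\<close> of evaluation of
  compactly supported sections.\<close>

definition eval_at ::
  "('x, 'e, 'm) fibrewise_bundle_scheme \<Rightarrow> ('a, 'n) normed_star_alg_scheme \<Rightarrow> (('x \<Rightarrow> 'e) \<Rightarrow> 'a) \<Rightarrow> 'x \<Rightarrow> 'a \<Rightarrow> 'e"
  where
  "eval_at B A j x =
     (THE f. f \<in> extensional (carrier A) \<and> complex_linear A (fib B x) f \<and>
        continuous_map (norm_topology A) (norm_topology (fib B x)) f \<and>
        (\<forall>s\<in>carrier (convolution_algebra B). f (j s) = s x))"

definition sigma_elem ::
  "('x, 'e, 'm) fibrewise_bundle_scheme \<Rightarrow> ('a, 'n) normed_star_alg_scheme \<Rightarrow> (('x \<Rightarrow> 'e) \<Rightarrow> 'a) \<Rightarrow> 'a \<Rightarrow> 'x set"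
  where
  "sigma_elem B A j a =
     base B interior_of {x \<in> topspace (base B). eval_at B A j x a \<noteq> \<zero>\<^bsub>fib B x\<^esub>}"

definition p_star ::
  "('x, 'e, 'm) fibrewise_bundle_scheme \<Rightarrow> ('a, 'n) normed_star_alg_scheme \<Rightarrow> (('x \<Rightarrow> 'e) \<Rightarrow> 'a) \<Rightarrow> 'x set \<Rightarrow> 'a set"
  where
  "p_star B A j V =
     closed_span A (\<Union>{j ` Cc_sections B U |U. openin (base B) U \<and> U \<subseteq> V})"

definition gamma ::
  "('x, 'e, 'm) fibrewise_bundle_scheme \<Rightarrow> ('a, 'n) normed_star_alg_scheme \<Rightarrow> (('x \<Rightarrow> 'e) \<Rightarrow> 'a) \<Rightarrow> 'x set \<Rightarrow> 'a set"
  where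
  "gamma B A j V = closed_span A {a \<in> carrier A. sigma_elem B A j a \<subseteq> V}"

definition localizable ::
  "('x, 'e, 'm) fibrewise_bundle_scheme \<Rightarrow> ('a, 'n) normed_star_alg_scheme \<Rightarrow> (('x \<Rightarrow> 'e) \<Rightarrow> 'a) \<Rightarrow> bool" where
  "localizable B A j \<longleftrightarrow> (\<forall>V. openin (base B) V \<longrightarrow> p_star B A j V = gamma B A j V)"

end

theory Submission
  imports Defs
begin

text \<open>
  Since the whole base space is open, a compatible norm on the compactly supported sections can
  only be the supremum norm.  A compatible completion \<open>A\<close> is therefore the completion of the
  compactly supported sections in the supremum norm, and the claim is that elements of this
  completion are the sections vanishing at infinity.

  Each evaluation of sections at a point \<open>x\<close> is contractive, so it extends to a map \<open>ev x\<close> from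
  \<open>A\<close> to the complete fibre over \<open>x\<close>.  The extension is described by the inequality
  \<open>\<parallel>s x - ev x a\<parallel> \<le> \<parallel>j s - a\<parallel>\<close> for all compactly supported \<open>s\<close>, from which the algebraic
  properties follow by approximation.  Collecting the evaluations gives a map \<open>sec\<close> from \<open>A\<close> to
  functions on the base space.  Three facts make it an isomorphism onto the sections vanishing at
  infinity.  Locally uniform limits of continuous sections are continuous
  (\<open>continuous_if_locally_approximable\<close>), so \<open>sec a\<close> is a continuous section.  The norm of \<open>A\<close> is
  controlled by the fibre norms of the evaluations (\<open>norm_dist_j_le_ev\<close>), so \<open>sec\<close> is injective.
  And every section vanishing at infinity is a uniform limit of compactly supported ones
  (\<open>Cc_approximation\<close>), so \<open>sec\<close> is surjective by completeness of \<open>A\<close>.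

  For localizability, let \<open>V\<close> be open.  Because the total space is Hausdorff, the set where a
  continuous section does not vanish is open (\<open>open_nonzero\<close>), so \<open>\<sigma>(\<langle>a\<rangle>) \<subseteq> V\<close> just says that
  \<open>sec a\<close> vanishes off \<open>V\<close>.  Multiplying \<open>sec a\<close> by a cutoff function that is 1 on the compact
  subset of \<open>V\<close> where its norm is at least \<open>\<epsilon>\<close> gives a section with compact support in \<open>V\<close> within
  \<open>\<epsilon>\<close> of \<open>sec a\<close>.  Hence \<open>a\<close> is in the closure of the image of these sections.
\<close>

section \<open>Normed modules and contractive extension\<close>

lemma carrier_complex_field [simp]: "carrier complex_field = UNIV"
  by (simp add: ring_of_type_algebra_def)

locale normed_module = Module.module complex_field M
  for M :: "('a, 'm) normed_star_alg_scheme" (structure) +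
  assumes vector_norm: "vector_norm M (nrm M)"
begin

lemma nrm_nonneg: "a \<in> carrier M \<Longrightarrow> 0 \<le> nrm M a"
  and nrm_eq_0_iff: "a \<in> carrier M \<Longrightarrow> nrm M a = 0 \<longleftrightarrow> a = \<zero>"
  and nrm_smult: "a \<in> carrier M \<Longrightarrow> nrm M (z \<odot> a) = cmod z * nrm M a"
  and nrm_triangle: "\<lbrakk>a \<in> carrier M; b \<in> carrier M\<rbrakk> \<Longrightarrow> nrm M (a \<oplus> b) \<le> nrm M a + nrm M b"
  using vector_norm unfolding vector_norm_def by auto

lemma nrm_zero [simp]: "nrm M \<zero> = 0"
  by (simp add: nrm_eq_0_iff)

lemma smult_carrier [simp, intro]: "a \<in> carrier M \<Longrightarrow> z \<odot> a \<in> carrier M"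
  by (simp add: smult_closed)

lemma smult_minus_one: "a \<in> carrier M \<Longrightarrow> (-1) \<odot> a = \<ominus> a"
proof -
  assume a: "a \<in> carrier M"
  have "\<ominus>\<^bsub>complex_field\<^esub> \<one>\<^bsub>complex_field\<^esub> = -1"
    by (rule R.minus_equality) (auto simp: ring_of_type_algebra_def)
  then show ?thesis
    using a smult_l_minus[of "\<one>\<^bsub>complex_field\<^esub>" a] by simp
qed

lemma smult_diff_left:
  "a \<in> carrier M \<Longrightarrow> z \<odot> a \<ominus> w \<odot> a = (z - w) \<odot> a"
proof -
  assume a: "a \<in> carrier M"
  have "z \<odot> a = (z - w) \<odot> a \<oplus> w \<odot> a"
    using smult_l_distr[of "z - w" w a] a by (simp add: ring_of_type_algebra_def)
  with a show ?thesis
    by (simp add: M.minus_eq M.a_assoc M.r_neg)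
qed

lemma nrm_minus: "a \<in> carrier M \<Longrightarrow> nrm M (\<ominus> a) = nrm M a"
  using nrm_smult[of a "-1"] by (simp add: smult_minus_one)

lemma norm_dist_eq: "\<lbrakk>a \<in> carrier M; b \<in> carrier M\<rbrakk> \<Longrightarrow> norm_dist M a b = nrm M (a \<ominus> b)"
  by (simp add: norm_dist_def)

lemma add_minus_cancel: "\<lbrakk>a \<in> carrier M; b \<in> carrier M\<rbrakk> \<Longrightarrow> b \<oplus> (a \<ominus> b) = a"
  by (metis M.a_comm M.minus_closed M.minus_eq M.a_assoc M.a_inv_closed M.l_neg M.r_zero)

lemma norm_dist_metric: "Metric_space (carrier M) (norm_dist M)"
proof
  fix a b c
  show "0 \<le> norm_dist M a b"
    by (simp add: norm_dist_def nrm_nonneg)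
  show "norm_dist M a b = norm_dist M b a"
  proof (cases "a \<in> carrier M \<and> b \<in> carrier M")
    case True
    then have "\<ominus> (a \<ominus> b) = b \<ominus> a"
      by (simp add: M.minus_eq M.minus_add M.a_comm)
    with True show ?thesis
      by (metis M.minus_closed norm_dist_eq nrm_minus)
  qed (auto simp: norm_dist_def)
  assume a: "a \<in> carrier M" and b: "b \<in> carrier M"
  show "norm_dist M a b = 0 \<longleftrightarrow> a = b"
    using a b add_minus_cancel[OF a b] by (auto simp: norm_dist_eq nrm_eq_0_iff M.minus_eq M.r_neg)
  assume c: "c \<in> carrier M"
  have "a \<ominus> c = (a \<ominus> b) \<oplus> (b \<ominus> c)"
    using a b c by (metis M.a_assoc M.minus_closed M.minus_eq M.a_inv_closed M.l_neg M.l_zero)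
  then show "norm_dist M a c \<le> norm_dist M a b + norm_dist M b c"
    using a b c nrm_triangle[of "a \<ominus> b" "b \<ominus> c"] by (simp add: norm_dist_eq)
qed

sublocale metric: Metric_space "carrier M" "norm_dist M"
  by (rule norm_dist_metric)

lemma norm_dist_zero: "a \<in> carrier M \<Longrightarrow> norm_dist M a \<zero> = nrm M a"
  using add_minus_cancel[of a \<zero>] by (simp add: norm_dist_eq)

lemma nrm_le_norm_dist:
  "\<lbrakk>a \<in> carrier M; b \<in> carrier M\<rbrakk> \<Longrightarrow> nrm M a \<le> nrm M b + norm_dist M a b"
  using metric.triangle[of a b \<zero>] by (simp add: norm_dist_zero)

lemma norm_dist_add:
  assumes "a \<in> carrier M" "b \<in> carrier M" "c \<in> carrier M" "d \<in> carrier M"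
  shows "norm_dist M (a \<oplus> b) (c \<oplus> d) \<le> norm_dist M a c + norm_dist M b d"
proof -
  have "(a \<oplus> b) \<ominus> (c \<oplus> d) = (a \<ominus> c) \<oplus> (b \<ominus> d)"
    using assms by (simp add: M.minus_eq M.minus_add M.a_ac)
  then show ?thesis
    using assms nrm_triangle[of "a \<ominus> c" "b \<ominus> d"] by (simp add: norm_dist_eq)
qed

lemma norm_dist_add_right:
  "\<lbrakk>a \<in> carrier M; b \<in> carrier M\<rbrakk> \<Longrightarrow> norm_dist M (a \<oplus> b) a = nrm M b"
  by (simp add: norm_dist_eq M.minus_eq M.a_comm[of a b] M.a_assoc M.r_neg)

lemma norm_dist_smult:
  assumes "a \<in> carrier M" "b \<in> carrier M"
  shows "norm_dist M (z \<odot> a) (z \<odot> b) = cmod z * norm_dist M a b"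
proof -
  have "z \<odot> a \<ominus> z \<odot> b = z \<odot> (a \<ominus> b)"
    using assms by (simp add: M.minus_eq smult_r_distr smult_r_minus)
  then show ?thesis
    using assms by (simp add: norm_dist_eq nrm_smult)
qed

lemma in_norm_closure_iff:
  "a \<in> norm_topology M closure_of S \<longleftrightarrow>
     a \<in> carrier M \<and> (\<forall>\<epsilon>>0. \<exists>b\<in>S. b \<in> carrier M \<and> norm_dist M b a < \<epsilon>)"
  unfolding norm_topology_def metric.metric_closure_of
  by (auto simp: metric.in_mball metric.commute)

end

text \<open>
  Contractions extend from a dense subset to complete targets: the values \<open>h (u n)\<close> along a sequence with \<open>j (u n) \<rightarrow> a\<close> are Cauchy,
  and their limit \<open>e\<close> inherits the contraction estimate.  The conclusion does not mention the
  sequence, so that \<open>e\<close> is later handled through the inequality alone.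
\<close>

lemma (in normed_module) contraction_extension:
  assumes F: "normed_module F" "Metric_space.mcomplete (carrier F) (norm_dist F)"
    and j: "j \<in> S \<rightarrow> carrier M" and h: "h \<in> S \<rightarrow> carrier F"
    and dense: "\<And>a \<epsilon>. \<lbrakk>a \<in> carrier M; 0 < \<epsilon>\<rbrakk> \<Longrightarrow> \<exists>s\<in>S. norm_dist M (j s) a < \<epsilon>"
    and contr: "\<And>s t. \<lbrakk>s \<in> S; t \<in> S\<rbrakk> \<Longrightarrow> norm_dist F (h s) (h t) \<le> norm_dist M (j s) (j t)"
    and a: "a \<in> carrier M"
  shows "\<exists>e\<in>carrier F. \<forall>s\<in>S. norm_dist F (h s) e \<le> norm_dist M (j s) a"
proof -
  interpret F: normed_module F by fact
  have jS: "j s \<in> carrier M" and hS: "h s \<in> carrier F" if "s \<in> S" for s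
    using that j h by auto
  have "\<forall>n. \<exists>s\<in>S. norm_dist M (j s) a < inverse (Suc n)"
    using dense[OF a] by simp
  then obtain u where u: "\<And>n. u n \<in> S" "\<And>n. norm_dist M (j (u n)) a < inverse (Suc n)"
    by metis
  have "F.metric.MCauchy (\<lambda>n. h (u n))"
    unfolding F.metric.MCauchy_def
  proof (intro conjI allI impI)
    show "range (\<lambda>n. h (u n)) \<subseteq> carrier F"
      using hS u by auto
    fix \<epsilon> :: real assume "\<epsilon> > 0"
    then obtain N where N: "inverse (Suc N) < \<epsilon> / 2"
      using reals_Archimedean[of "\<epsilon> / 2"] by auto
    have near: "norm_dist M (j (u n)) a < \<epsilon> / 2" if "N \<le> n" for n
    proof -
      have "inverse (real (Suc n)) \<le> inverse (Suc N)"
        using that by (simp add: field_simps)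
      then show ?thesis
        using u(2)[of n] N by linarith
    qed
    have "norm_dist F (h (u n)) (h (u m)) < \<epsilon>" if "N \<le> n" "N \<le> m" for n m
      using contr[OF u(1) u(1), of n m] near[OF that(1)] near[OF that(2)]
        metric.triangle[of "j (u n)" a "j (u m)"] metric.commute[of a "j (u m)"] jS u(1) a
      by force
    then show "\<exists>N. \<forall>n n'. N \<le> n \<longrightarrow> N \<le> n' \<longrightarrow> norm_dist F (h (u n)) (h (u n')) < \<epsilon>"
      by blast
  qed
  then obtain e where e: "limitin F.metric.mtopology (\<lambda>n. h (u n)) e sequentially"
    using F(2) F.metric.mcomplete_def by blast
  then have eF: "e \<in> carrier F"
    by (rule F.metric.limitin_mspace)
  have "norm_dist F (h s) e \<le> norm_dist M (j s) a" if s: "s \<in> S" for s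
  proof (rule field_le_epsilon)
    fix \<epsilon> :: real assume "0 < \<epsilon>"
    then have "\<forall>\<^sub>F n in sequentially. norm_dist F (h (u n)) e < \<epsilon> / 2"
      using e unfolding F.metric.limit_metric_sequentially eventually_sequentially
      by (meson half_gt_zero)
    moreover have "\<forall>\<^sub>F n in sequentially. inverse (real (Suc n)) < \<epsilon> / 2"
      using \<open>0 < \<epsilon>\<close> by (intro Archimedean_eventually_inverse[THEN iffD2]) auto
    ultimately obtain n where n: "norm_dist F (h (u n)) e < \<epsilon> / 2" "inverse (Suc n) < \<epsilon> / 2"
      using eventually_conj eventually_happens'[OF sequentially_bot] by (metis (mono_tags, lifting))
    have "norm_dist F (h s) e \<le> norm_dist F (h s) (h (u n)) + norm_dist F (h (u n)) e"
      using s u(1) eF hS by (intro F.metric.triangle) auto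
    moreover have "norm_dist M (j s) (j (u n)) \<le> norm_dist M (j s) a + norm_dist M (j (u n)) a"
      using metric.triangle[of "j s" a "j (u n)"] metric.commute[of a] jS s u(1) a by force
    ultimately show "norm_dist F (h s) e \<le> norm_dist M (j s) a + \<epsilon>"
      using contr[OF s u(1), of n] n u(2)[of n] by linarith
  qed
  with eF show ?thesis by blast
qed

locale normed_cstar_algebra =
  fixes M :: "('a, 'm) normed_star_alg_scheme" (structure)
  assumes cstar_algebra: "cstar_algebra M"

sublocale normed_cstar_algebra \<subseteq> star_algebra M
  using cstar_algebra unfolding cstar_algebra_def by blast

sublocale normed_cstar_algebra \<subseteq> normed_module M
  using cstar_algebra unfolding cstar_algebra_def banach_space_def
  by (intro normed_module.intro normed_module_axioms.intro) auto

context normed_cstar_algebra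
begin

lemma nrm_mult: "\<lbrakk>a \<in> carrier M; b \<in> carrier M\<rbrakk> \<Longrightarrow> nrm M (a \<otimes> b) \<le> nrm M a * nrm M b"
  and cstar_identity: "a \<in> carrier M \<Longrightarrow> nrm M (star M a \<otimes> a) = (nrm M a)\<^sup>2"
  using cstar_algebra unfolding cstar_algebra_def cstar_norm_def by auto

text \<open>
  The involution is isometric, since \<open>\<parallel>b\<parallel>\<^sup>2 = \<parallel>b\<^sup>* b\<parallel> \<le> \<parallel>b\<^sup>*\<parallel> \<parallel>b\<parallel>\<close> for \<open>b = a\<close> and for \<open>b = a\<^sup>*\<close>.
\<close>

lemma nrm_star: assumes a: "a \<in> carrier M" shows "nrm M (star M a) = nrm M a"
proof -
  have le: "nrm M b \<le> nrm M (star M b)" if b: "b \<in> carrier M" for b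
  proof (cases "nrm M b = 0")
    case False
    then have "nrm M b > 0"
      using nrm_nonneg[OF b] by simp
    moreover have "nrm M b * nrm M b \<le> nrm M (star M b) * nrm M b"
      using nrm_mult[of "star M b" b] b star_closed cstar_identity[OF b]
      by (simp add: power2_eq_square)
    ultimately show ?thesis
      by simp
  qed (use that nrm_nonneg star_closed in auto)
  from le[OF a] le[OF star_closed[OF a]] show ?thesis
    using star_star[OF a] by simp
qed

lemma star_minus:
  assumes "a \<in> carrier M" "b \<in> carrier M"
  shows "star M (a \<ominus> b) = star M a \<ominus> star M b"
proof -
  have "a \<ominus> b = a \<oplus> (-1) \<odot> b"
    using assms by (simp add: M.minus_eq smult_minus_one)
  then have "star M (a \<ominus> b) = star M a \<oplus> (-1) \<odot> star M b"
    using assms by (simp add: star_add star_smult)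
  then show ?thesis
    using assms by (simp add: M.minus_eq smult_minus_one star_closed)
qed

lemma norm_dist_star:
  assumes "a \<in> carrier M" "b \<in> carrier M"
  shows "norm_dist M (star M a) (star M b) = norm_dist M a b"
  using assms nrm_star[of "a \<ominus> b"] by (simp add: norm_dist_eq star_closed star_minus)

text \<open>
  Continuity of the multiplication with an explicit modulus that depends only on \<open>\<parallel>a\<parallel>\<close> and
  \<open>\<parallel>b\<parallel>\<close>: write \<open>st - ab = s (t - b) + (s - a) b\<close>.
\<close>

lemma norm_dist_mult:
  assumes "a \<in> carrier M" "b \<in> carrier M" "s \<in> carrier M" "t \<in> carrier M"
    and sa: "norm_dist M s a \<le> \<delta>" and tb: "norm_dist M t b \<le> \<delta>" and \<delta>: "\<delta> \<le> 1"
  shows "norm_dist M (s \<otimes> t) (a \<otimes> b) \<le> \<delta> * (nrm M a + nrm M b + 1)"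
proof -
  have \<delta>0: "0 \<le> \<delta>"
    using sa metric.nonneg order_trans by blast
  have s: "s = a \<oplus> (s \<ominus> a)" and t: "t = b \<oplus> (t \<ominus> b)"
    using assms by (simp_all add: add_minus_cancel)
  have eq1: "s \<otimes> t = s \<otimes> b \<oplus> s \<otimes> (t \<ominus> b)"
    using assms mult_add_right[of s b "t \<ominus> b"] t by simp
  have eq2: "s \<otimes> b = a \<otimes> b \<oplus> (s \<ominus> a) \<otimes> b"
    using assms mult_add_left[of a "s \<ominus> a" b] s by simp
  have "norm_dist M (s \<otimes> t) (a \<otimes> b) \<le> norm_dist M (s \<otimes> t) (s \<otimes> b) + norm_dist M (s \<otimes> b) (a \<otimes> b)"
    using assms by (intro metric.triangle mult_closed)
  also have "norm_dist M (s \<otimes> t) (s \<otimes> b) = nrm M (s \<otimes> (t \<ominus> b))"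
    unfolding eq1 using assms by (intro norm_dist_add_right mult_closed) auto
  also have "norm_dist M (s \<otimes> b) (a \<otimes> b) = nrm M ((s \<ominus> a) \<otimes> b)"
    unfolding eq2 using assms by (intro norm_dist_add_right mult_closed) auto
  also have "nrm M (s \<otimes> (t \<ominus> b)) \<le> (nrm M a + 1) * \<delta>"
  proof -
    have "nrm M s \<le> nrm M a + 1"
      using nrm_le_norm_dist[of s a] assms by linarith
    moreover have "nrm M (t \<ominus> b) \<le> \<delta>"
      using assms by (simp add: norm_dist_eq)
    ultimately show ?thesis
      using assms nrm_mult[of s "t \<ominus> b"] mult_mono[of "nrm M s" "nrm M a + 1" "nrm M (t \<ominus> b)" \<delta>]
        nrm_nonneg[of a] nrm_nonneg[of "t \<ominus> b"] by simp
  qed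
  also have "nrm M ((s \<ominus> a) \<otimes> b) \<le> \<delta> * nrm M b"
    using assms nrm_mult[of "s \<ominus> a" b] mult_right_mono[of "nrm M (s \<ominus> a)" \<delta> "nrm M b"]
      nrm_nonneg[of b] by (simp add: norm_dist_eq)
  finally show ?thesis
    by (simp add: algebra_simps)
qed

end

section \<open>Continuous sections of a Banach bundle\<close>

locale usc_banach_bundle =
  fixes B :: "('x, 'e, 'm) fibrewise_bundle_scheme"
  assumes banach_bundle: "banach_bundle B"
begin

abbreviation pts :: "'x set" where "pts \<equiv> topspace (base B)"

lemma Hausdorff_base: "Hausdorff_space (base B)"
  and Hausdorff_total: "Hausdorff_space (total B)"
  and continuous_proj: "continuous_map (total B) (base B) (proj B)"
  and open_proj: "open_map (total B) (base B) (proj B)"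
  and continuous_add: "continuous_map (fibre_product B) (total B) (\<lambda>(e, f). e \<oplus>\<^bsub>fib B (proj B e)\<^esub> f)"
  and continuous_smult: "continuous_map (total B) (total B) (\<lambda>e. z \<odot>\<^bsub>fib B (proj B e)\<^esub> e)"
  and open_norm_less: "openin (total B) {e \<in> topspace (total B). nrm (fib B (proj B e)) e < r}"
  using banach_bundle unfolding banach_bundle_def by blast+

lemma carrier_fib: "x \<in> pts \<Longrightarrow> carrier (fib B x) = {e \<in> topspace (total B). proj B e = x}"
  and banach_fib: "x \<in> pts \<Longrightarrow> banach_space (fib B x)"
  using banach_bundle unfolding banach_bundle_def by blast+

lemma proj_in_base: "e \<in> topspace (total B) \<Longrightarrow> proj B e \<in> pts"
  using continuous_proj continuous_map_funspace by blast

lemma normed_fib: "x \<in> pts \<Longrightarrow> normed_module (fib B x)"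
  using banach_fib unfolding banach_space_def
  by (intro normed_module.intro normed_module_axioms.intro) auto

lemma complete_fib: "x \<in> pts \<Longrightarrow> Metric_space.mcomplete (carrier (fib B x)) (norm_dist (fib B x))"
  using banach_fib unfolding banach_space_def by blast

lemma small_near_zero:
  assumes "x \<in> pts" "openin (total B) V" "\<zero>\<^bsub>fib B x\<^esub> \<in> V"
  obtains \<epsilon> U where "0 < \<epsilon>" "openin (base B) U" "x \<in> U"
    "\<And>y e. \<lbrakk>y \<in> U; e \<in> carrier (fib B y); nrm (fib B y) e < \<epsilon>\<rbrakk> \<Longrightarrow> e \<in> V"
proof -
  obtain \<epsilon> U where "0 < \<epsilon>" and U: "openin (base B) U" "x \<in> U"
    and sub: "{e \<in> topspace (total B). proj B e \<in> U \<and> nrm (fib B (proj B e)) e < \<epsilon>} \<subseteq> V"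
    using banach_bundle assms unfolding banach_bundle_def by meson
  have "e \<in> V" if "y \<in> U" "e \<in> carrier (fib B y)" "nrm (fib B y) e < \<epsilon>" for y e
  proof -
    have "e \<in> topspace (total B)" "proj B e = y"
      using that openin_subset[OF U(1)] carrier_fib[of y] by auto
    with that sub show ?thesis by blast
  qed
  with \<open>0 < \<epsilon>\<close> U that show thesis by blast
qed

lemma continuous_fibrewise_binop:
  assumes op: "continuous_map (fibre_product B) (total B) (\<lambda>(e, f). op (proj B e) e f)"
    and s: "continuous_map Y (total B) s" and t: "continuous_map Y (total B) t"
    and st: "\<And>y. y \<in> topspace Y \<Longrightarrow> proj B (s y) = p y \<and> proj B (t y) = p y"
  shows "continuous_map Y (total B) (\<lambda>y. op (p y) (s y) (t y))"
proof -
  have "continuous_map Y (fibre_product B) (\<lambda>y. (s y, t y))"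
    unfolding fibre_product_def using s t st
    by (intro continuous_map_into_subtopology continuous_map_pairedI) auto
  from continuous_map_compose[OF this op] show ?thesis
    by (rule continuous_map_eq) (use st in auto)
qed

lemma continuous_fibrewise_diff:
  assumes s: "continuous_map Y (total B) s" and t: "continuous_map Y (total B) t"
    and st: "\<And>y. y \<in> topspace Y \<Longrightarrow> proj B (s y) = p y \<and> proj B (t y) = p y"
  shows "continuous_map Y (total B) (\<lambda>y. s y \<ominus>\<^bsub>fib B (p y)\<^esub> t y)"
proof -
  have carrier: "p y \<in> pts \<and> s y \<in> carrier (fib B (p y)) \<and> t y \<in> carrier (fib B (p y))"
    if "y \<in> topspace Y" for y
  proof -
    have "s y \<in> topspace (total B)" "t y \<in> topspace (total B)"
      using s t that continuous_map_image_subset_topspace by blast+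
    then show ?thesis
      using st[OF that] proj_in_base[of "s y"] carrier_fib[of "p y"] by auto
  qed
  have neg: "(-1) \<odot>\<^bsub>fib B (p y)\<^esub> t y = \<ominus>\<^bsub>fib B (p y)\<^esub> t y"
    if "y \<in> topspace Y" for y
    using normed_module.smult_minus_one[OF normed_fib] carrier[OF that] by blast
  have "continuous_map Y (total B) (\<lambda>y. (-1) \<odot>\<^bsub>fib B (p y)\<^esub> t y)"
    using continuous_map_compose[OF t continuous_smult[of "-1"]]
    by (rule continuous_map_eq) (use st in auto)
  moreover have "proj B ((-1) \<odot>\<^bsub>fib B (p y)\<^esub> t y) = p y" if "y \<in> topspace Y" for y
  proof -
    interpret F: normed_module "fib B (p y)"
      using normed_fib carrier[OF that] by blast
    have "(-1) \<odot>\<^bsub>fib B (p y)\<^esub> t y \<in> carrier (fib B (p y))"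
      using carrier[OF that] by blast
    then show ?thesis
      using carrier[OF that] carrier_fib by blast
  qed
  ultimately have "continuous_map Y (total B)
      (\<lambda>y. s y \<oplus>\<^bsub>fib B (p y)\<^esub> ((-1) \<odot>\<^bsub>fib B (p y)\<^esub> t y))"
    using s st by (intro continuous_fibrewise_binop[where op = "\<lambda>x. (\<oplus>\<^bsub>fib B x\<^esub>)"] continuous_add) auto
  then show ?thesis
    by (rule continuous_map_eq) (simp add: neg a_minus_def)
qed

lemma section_in_fib: "\<lbrakk>s \<in> continuous_sections B; x \<in> pts\<rbrakk> \<Longrightarrow> s x \<in> carrier (fib B x)"
  unfolding continuous_sections_def
  using carrier_fib continuous_map_image_subset_topspace by fastforce

lemma continuous_section:
  "s \<in> continuous_sections B \<Longrightarrow> continuous_map (base B) (total B) s"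
  by (simp add: continuous_sections_def)

lemma proj_section: "\<lbrakk>s \<in> continuous_sections B; x \<in> pts\<rbrakk> \<Longrightarrow> proj B (s x) = x"
  by (simp add: continuous_sections_def)

lemma restrict_continuous_section:
  assumes "continuous_map (base B) (total B) s" "\<And>x. x \<in> pts \<Longrightarrow> s x \<in> carrier (fib B x)"
  shows "restrict s pts \<in> continuous_sections B"
proof -
  have "continuous_map (base B) (total B) (restrict s pts)"
    using assms(1) by (rule continuous_map_eq) auto
  then show ?thesis
    using assms(2) carrier_fib unfolding continuous_sections_def by auto
qed

text \<open>
  A set-theoretic section is continuous as soon as it is locally a uniform limit of continuous
  sections.  The total space need not be locally trivial, so the usual three-epsilon argument has
  no common space to take place in; instead, openness of the projection moves points between
  fibres.  Given a neighbourhood \<open>V\<close> of \<open>s x\<close>, the points \<open>f\<close> near \<open>s x\<close> that are norm-close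
  to an approximating section \<open>t\<close> form an open set \<open>W\<close>, by upper semicontinuity of the norm,
  and \<open>W\<close> meets every fibre over a neighbourhood of \<open>x\<close>.  For such \<open>f\<close> over \<open>y\<close> the
  difference \<open>s y - f\<close> is small in norm, hence close to the zero section, and
  \<open>s y = f + (s y - f)\<close> lies in \<open>V\<close> by continuity of the addition.
\<close>

lemma continuous_if_locally_approximable:
  assumes s: "\<And>x. x \<in> pts \<Longrightarrow> s x \<in> carrier (fib B x)"
    and approx: "\<And>x \<epsilon>. \<lbrakk>x \<in> pts; 0 < \<epsilon>\<rbrakk> \<Longrightarrow> \<exists>t U. t \<in> continuous_sections B \<and> openin (base B) U \<and>
      x \<in> U \<and> (\<forall>y\<in>U. norm_dist (fib B y) (t y) (s y) < \<epsilon>)"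
  shows "continuous_map (base B) (total B) s"
  unfolding continuous_map_eq_topcontinuous_at topcontinuous_at_def
proof (intro ballI conjI allI impI)
  show "s \<in> pts \<rightarrow> topspace (total B)"
    using s carrier_fib by blast
next
  fix x V
  assume x: "x \<in> pts" and V: "openin (total B) V \<and> s x \<in> V"
  interpret Fx: normed_module "fib B x" using normed_fib[OF x] .
  obtain T where T: "openin (prod_topology (total B) (total B)) T"
    and eqT: "{q \<in> topspace (fibre_product B). (\<lambda>(e, f). e \<oplus>\<^bsub>fib B (proj B e)\<^esub> f) q \<in> V}
        = T \<inter> {(e, f). proj B e = proj B f}"
    using openin_continuous_map_preimage[OF continuous_add conjunct1[OF V]]
    unfolding fibre_product_def openin_subtopology by blast
  have "(s x, \<zero>\<^bsub>fib B x\<^esub>) \<in> T \<inter> {(e, f). proj B e = proj B f}"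
    unfolding eqT[symmetric] fibre_product_def using V s[OF x] carrier_fib[OF x] Fx.zero_closed
    by auto
  then have "(s x, \<zero>\<^bsub>fib B x\<^esub>) \<in> T" by blast
  then obtain V1 V2 where V1: "openin (total B) V1" "s x \<in> V1"
    and V2: "openin (total B) V2" "\<zero>\<^bsub>fib B x\<^esub> \<in> V2" and V12: "V1 \<times> V2 \<subseteq> T"
    using T unfolding openin_prod_topology_alt by meson
  obtain \<epsilon> U0 where "0 < \<epsilon>" and U0: "openin (base B) U0" "x \<in> U0"
    and small: "\<And>y e. \<lbrakk>y \<in> U0; e \<in> carrier (fib B y); nrm (fib B y) e < \<epsilon>\<rbrakk> \<Longrightarrow> e \<in> V2"
    using small_near_zero[OF x V2] by metis
  obtain t U1 where t: "t \<in> continuous_sections B" and U1: "openin (base B) U1" "x \<in> U1"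
    and ts: "\<And>y. y \<in> U1 \<Longrightarrow> norm_dist (fib B y) (t y) (s y) < \<epsilon> / 2"
    using approx[OF x, of "\<epsilon> / 2"] \<open>0 < \<epsilon>\<close> by auto
  define D where "D = (\<lambda>f. f \<ominus>\<^bsub>fib B (proj B f)\<^esub> t (proj B f))"
  have D: "continuous_map (total B) (total B) D"
    unfolding D_def
  proof (rule continuous_fibrewise_diff)
    show "continuous_map (total B) (total B) (\<lambda>f. t (proj B f))"
      using continuous_map_compose[OF continuous_proj continuous_section[OF t]] by (simp add: o_def)
    show "proj B f = proj B f \<and> proj B (t (proj B f)) = proj B f" if "f \<in> topspace (total B)" for f
      using that proj_section[OF t] proj_in_base by blast
  qed auto
  \<comment> \<open>The points of \<open>V1\<close> that are closer than \<open>\<epsilon> / 2\<close> to the value of \<open>t\<close> in their fibre.\<close>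
  define W where "W = {f \<in> V1. D f \<in> {e \<in> topspace (total B). nrm (fib B (proj B e)) e < \<epsilon> / 2}}"
  have "openin (total B) W"
    unfolding W_def by (intro openin_continuous_map_preimage_gen[OF D] V1 open_norm_less)
  then have projW: "openin (base B) (proj B ` W)"
    using open_proj unfolding open_map_def by blast
  have W_dist: "norm_dist (fib B y) (t y) f < \<epsilon> / 2 \<longleftrightarrow> f \<in> W"
    if "f \<in> V1" "f \<in> carrier (fib B y)" "y \<in> pts" for f y
  proof -
    interpret Fy: normed_module "fib B y" using normed_fib[OF that(3)] .
    have f: "f \<in> topspace (total B)" "proj B f = y"
      using that carrier_fib by auto
    have ty: "t y \<in> carrier (fib B y)"
      using section_in_fib[OF t that(3)] .
    have "D f \<in> carrier (fib B y)"
      unfolding D_def f using that ty by simp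
    then have Df: "D f \<in> topspace (total B)" "proj B (D f) = y"
      using carrier_fib[OF that(3)] by auto
    show ?thesis
      using that ty Df f unfolding W_def
      by (simp add: Fy.metric.commute[of "t y"] Fy.norm_dist_eq D_def)
  qed
  have "s x \<in> W"
    using W_dist[OF V1(2) s[OF x] x] ts[OF U1(2)] by blast
  then have "x \<in> proj B ` W"
    using s[OF x] carrier_fib[OF x] by force
  moreover have "s y \<in> V" if y: "y \<in> U0 \<inter> U1 \<inter> proj B ` W" for y
  proof -
    from y obtain f where f: "f \<in> W" "proj B f = y" by blast
    have yX: "y \<in> pts"
      using y openin_subset[OF U0(1)] by blast
    interpret Fy: normed_module "fib B y" using normed_fib[OF yX] .
    have fV1: "f \<in> V1" and fy: "f \<in> carrier (fib B y)"
      using f openin_subset[OF V1(1)] carrier_fib[OF yX] unfolding W_def by auto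
    have d: "s y \<ominus>\<^bsub>fib B y\<^esub> f \<in> carrier (fib B y)"
      using s[OF yX] fy by simp
    have "norm_dist (fib B y) (s y) f \<le> norm_dist (fib B y) (t y) (s y) + norm_dist (fib B y) (t y) f"
      using Fy.metric.triangle[of "s y" "t y" f] Fy.metric.commute[of "s y"]
        s[OF yX] fy section_in_fib[OF t yX] by simp
    also have "\<dots> < \<epsilon>"
      using ts[of y] y W_dist[OF fV1 fy yX] f(1) by fastforce
    finally have "s y \<ominus>\<^bsub>fib B y\<^esub> f \<in> V2"
      using small[of y "s y \<ominus>\<^bsub>fib B y\<^esub> f"] y s[OF yX] fy d by (simp add: Fy.norm_dist_eq)
    moreover have "proj B (s y \<ominus>\<^bsub>fib B y\<^esub> f) = y"
      using d carrier_fib[OF yX] by blast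
    ultimately have "(f, s y \<ominus>\<^bsub>fib B y\<^esub> f) \<in> T \<inter> {(e, f). proj B e = proj B f}"
      using fV1 V12 f(2) by auto
    then have "f \<oplus>\<^bsub>fib B y\<^esub> (s y \<ominus>\<^bsub>fib B y\<^esub> f) \<in> V"
      unfolding eqT[symmetric] using f(2) by auto
    then show ?thesis
      using Fy.add_minus_cancel[OF s[OF yX] fy] by simp
  qed
  ultimately show "\<exists>U. openin (base B) U \<and> x \<in> U \<and> (\<forall>y\<in>U. s y \<in> V)"
    using U0 U1 projW by (intro exI[of _ "U0 \<inter> U1 \<inter> proj B ` W"]) auto
qed auto

text \<open>
  The neighbourhoods of \<open>0\<^sub>x\<close> contain all vectors of small norm over a neighbourhood of \<open>x\<close>, in
  particular the zeros there.
\<close>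

lemma zero_section: "(\<lambda>x\<in>pts. \<zero>\<^bsub>fib B x\<^esub>) \<in> continuous_sections B"
proof (rule restrict_continuous_section)
  show z: "\<zero>\<^bsub>fib B x\<^esub> \<in> carrier (fib B x)" if "x \<in> pts" for x
  proof -
    interpret normed_module "fib B x" using normed_fib[OF that] .
    show ?thesis by simp
  qed
  show "continuous_map (base B) (total B) (\<lambda>x. \<zero>\<^bsub>fib B x\<^esub>)"
    unfolding continuous_map_eq_topcontinuous_at topcontinuous_at_def
  proof (intro ballI conjI allI impI)
    show "(\<lambda>x. \<zero>\<^bsub>fib B x\<^esub>) \<in> pts \<rightarrow> topspace (total B)"
      using z carrier_fib by blast
    fix x V assume x: "x \<in> pts" and V: "openin (total B) V \<and> \<zero>\<^bsub>fib B x\<^esub> \<in> V"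
    then obtain \<epsilon> U where "0 < \<epsilon>" and U: "openin (base B) U" "x \<in> U"
      and small: "\<And>y e. \<lbrakk>y \<in> U; e \<in> carrier (fib B y); nrm (fib B y) e < \<epsilon>\<rbrakk> \<Longrightarrow> e \<in> V"
      using small_near_zero by metis
    have "\<zero>\<^bsub>fib B y\<^esub> \<in> V" if "y \<in> U" for y
    proof -
      have yX: "y \<in> pts" using that openin_subset[OF U(1)] by blast
      show ?thesis
        using small[OF that z[OF yX]] \<open>0 < \<epsilon>\<close> normed_module.nrm_eq_0_iff[OF normed_fib[OF yX] z[OF yX]]
        by simp
    qed
    with U show "\<exists>U. openin (base B) U \<and> x \<in> U \<and> (\<forall>y\<in>U. \<zero>\<^bsub>fib B y\<^esub> \<in> V)" by blast
  qed auto
qed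

text \<open>
  Although the norm is only upper semicontinuous, the set where a section does not vanish is
  open: it is the complement of the coincidence set of two continuous maps into the Hausdorff
  total space.
\<close>

lemma open_nonzero:
  assumes s: "s \<in> continuous_sections B"
  shows "openin (base B) {x \<in> pts. s x \<noteq> \<zero>\<^bsub>fib B x\<^esub>}"
proof -
  have "closedin (base B) {x \<in> pts. s x = (\<lambda>x\<in>pts. \<zero>\<^bsub>fib B x\<^esub>) x}"
    using s zero_section by (intro closedin_continuous_maps_eq[OF Hausdorff_total] continuous_section)
  then have "openin (base B) (pts - {x \<in> pts. s x = (\<lambda>x\<in>pts. \<zero>\<^bsub>fib B x\<^esub>) x})"
    by blast
  also have "pts - {x \<in> pts. s x = (\<lambda>x\<in>pts. \<zero>\<^bsub>fib B x\<^esub>) x} = {x \<in> pts. s x \<noteq> \<zero>\<^bsub>fib B x\<^esub>}"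
    by auto
  finally show ?thesis .
qed

lemma open_norm_section_less:
  assumes s: "s \<in> continuous_sections B"
  shows "openin (base B) {x \<in> pts. nrm (fib B x) (s x) < r}"
proof -
  have "openin (base B) {x \<in> pts. s x \<in> {e \<in> topspace (total B). nrm (fib B (proj B e)) e < r}}"
    by (intro openin_continuous_map_preimage[OF continuous_section[OF s]] open_norm_less)
  also have "{x \<in> pts. s x \<in> {e \<in> topspace (total B). nrm (fib B (proj B e)) e < r}}
      = {x \<in> pts. nrm (fib B x) (s x) < r}"
    using section_in_fib[OF s] carrier_fib by auto
  finally show ?thesis .
qed

lemma add_section:
  assumes "s \<in> continuous_sections B" "t \<in> continuous_sections B"
  shows "(\<lambda>x\<in>pts. s x \<oplus>\<^bsub>fib B x\<^esub> t x) \<in> continuous_sections B"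
proof (rule restrict_continuous_section)
  show "continuous_map (base B) (total B) (\<lambda>x. s x \<oplus>\<^bsub>fib B x\<^esub> t x)"
    using assms by (intro continuous_fibrewise_binop[where op = "\<lambda>x. (\<oplus>\<^bsub>fib B x\<^esub>)"]
      continuous_add continuous_section) (auto simp: proj_section)
  fix x assume x: "x \<in> pts"
  then interpret normed_module "fib B x" using normed_fib by blast
  show "s x \<oplus>\<^bsub>fib B x\<^esub> t x \<in> carrier (fib B x)"
    using assms x section_in_fib by simp
qed

lemma smult_section:
  assumes "s \<in> continuous_sections B"
  shows "(\<lambda>x\<in>pts. z \<odot>\<^bsub>fib B x\<^esub> s x) \<in> continuous_sections B"
proof (rule restrict_continuous_section)
  show "continuous_map (base B) (total B) (\<lambda>x. z \<odot>\<^bsub>fib B x\<^esub> s x)"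
    using continuous_map_compose[OF continuous_section[OF assms] continuous_smult[of z]]
    by (rule continuous_map_eq) (use assms proj_section in auto)
  fix x assume x: "x \<in> pts"
  then interpret normed_module "fib B x" using normed_fib by blast
  show "z \<odot>\<^bsub>fib B x\<^esub> s x \<in> carrier (fib B x)"
    using assms x section_in_fib by simp
qed

text \<open>
  The axioms give continuity of the multiplication by each fixed scalar.  Near \<open>x\<close> the section
  \<open>\<phi> s\<close> is approximated by \<open>\<phi> x\<close> times \<open>s\<close>, with error \<open>\<bar>\<phi> y - \<phi> x\<bar> \<parallel>s y\<parallel>\<close>, and the
  norm of \<open>s\<close> is locally bounded by upper semicontinuity.
\<close>

lemma scalar_function_section:
  fixes \<phi> :: "'x \<Rightarrow> real"
  assumes \<phi>: "continuous_map (base B) euclideanreal \<phi>" and s: "s \<in> continuous_sections B"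
  shows "(\<lambda>x\<in>pts. complex_of_real (\<phi> x) \<odot>\<^bsub>fib B x\<^esub> s x) \<in> continuous_sections B"
proof (rule restrict_continuous_section)
  show in_fib: "complex_of_real (\<phi> x) \<odot>\<^bsub>fib B x\<^esub> s x \<in> carrier (fib B x)" if "x \<in> pts" for x
  proof -
    interpret normed_module "fib B x" using normed_fib that by blast
    show ?thesis using s that section_in_fib by simp
  qed
  show "continuous_map (base B) (total B) (\<lambda>x. complex_of_real (\<phi> x) \<odot>\<^bsub>fib B x\<^esub> s x)"
  proof (rule continuous_if_locally_approximable[OF in_fib])
    fix x \<epsilon> assume x: "x \<in> pts" and "0 < (\<epsilon> :: real)"
    define m where "m = nrm (fib B x) (s x) + 1"
    have "0 < m"
      unfolding m_def
      using normed_module.nrm_nonneg[OF normed_fib[OF x] section_in_fib[OF s x]] by linarith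
    define U where "U = {y \<in> pts. nrm (fib B y) (s y) < m} \<inter> {y \<in> pts. \<phi> y \<in> ball (\<phi> x) (\<epsilon> / m)}"
    have U: "openin (base B) U"
      unfolding U_def
      by (intro openin_Int open_norm_section_less[OF s] openin_continuous_map_preimage[OF \<phi>]) simp
    have xU: "x \<in> U"
      using x \<open>0 < m\<close> \<open>0 < \<epsilon>\<close> unfolding U_def by (auto simp: m_def)
    have "norm_dist (fib B y) ((\<lambda>y\<in>pts. complex_of_real (\<phi> x) \<odot>\<^bsub>fib B y\<^esub> s y) y)
        (complex_of_real (\<phi> y) \<odot>\<^bsub>fib B y\<^esub> s y) < \<epsilon>" if "y \<in> U" for y
    proof -
      have y: "y \<in> pts" "nrm (fib B y) (s y) < m" "\<bar>\<phi> x - \<phi> y\<bar> < \<epsilon> / m"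
        using that unfolding U_def by (auto simp: dist_real_def)
      interpret Fy: normed_module "fib B y" using normed_fib[OF y(1)] .
      have sy: "s y \<in> carrier (fib B y)" using section_in_fib[OF s y(1)] .
      have "norm_dist (fib B y) (complex_of_real (\<phi> x) \<odot>\<^bsub>fib B y\<^esub> s y)
          (complex_of_real (\<phi> y) \<odot>\<^bsub>fib B y\<^esub> s y) = \<bar>\<phi> x - \<phi> y\<bar> * nrm (fib B y) (s y)"
        using sy by (simp add: Fy.norm_dist_eq Fy.smult_diff_left Fy.nrm_smult
            flip: of_real_diff)
      also have "\<dots> \<le> \<bar>\<phi> x - \<phi> y\<bar> * m"
        using y(2) by (intro mult_left_mono) auto
      also have "\<dots> < \<epsilon>"
        using y(3) \<open>0 < m\<close> by (simp add: field_simps)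
      finally show ?thesis using y(1) by simp
    qed
    with U xU smult_section[OF s, of "complex_of_real (\<phi> x)"]
    show "\<exists>t U. t \<in> continuous_sections B \<and> openin (base B) U \<and> x \<in> U \<and>
        (\<forall>y\<in>U. norm_dist (fib B y) (t y) (complex_of_real (\<phi> y) \<odot>\<^bsub>fib B y\<^esub> s y) < \<epsilon>)"
      by blast
  qed
qed

end

section \<open>Compactly supported sections\<close>

text \<open>
  Local compactness of the subspace \<open>V\<close>, rather than of \<open>Y\<close>, gives a compact neighbourhood
  \<open>L\<close> of \<open>K\<close> inside \<open>V\<close>; Urysohn's lemma separates \<open>K\<close> from the
  complement of an open set between \<open>K\<close> and \<open>L\<close>.
\<close>

lemma compact_cutoff:
  assumes Y: "locally_compact_space Y" "Hausdorff_space Y"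
    and K: "compactin Y K" and V: "openin Y V" "K \<subseteq> V"
  obtains \<phi> :: "'a \<Rightarrow> real" and L where "continuous_map Y euclideanreal \<phi>"
    "\<And>x. x \<in> topspace Y \<Longrightarrow> 0 \<le> \<phi> x \<and> \<phi> x \<le> 1" "\<And>x. x \<in> K \<Longrightarrow> \<phi> x = 1"
    "compactin Y L" "L \<subseteq> V" "\<And>x. \<lbrakk>x \<in> topspace Y; x \<notin> L\<rbrakk> \<Longrightarrow> \<phi> x = 0"
proof -
  have "locally_compact_space (subtopology Y V)" "Hausdorff_space (subtopology Y V)"
    using Y V(1) by (auto intro: locally_compact_space_open_subset Hausdorff_space_subtopology)
  moreover have "compactin (subtopology Y V) K"
    using K V(2) by (simp add: compactin_subtopology)
  ultimately obtain W L where W: "openin (subtopology Y V) W" "K \<subseteq> W" "W \<subseteq> L"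
    and L: "compactin (subtopology Y V) L"
    using locally_compact_space_compact_closed_compact by metis
  have W_open: "openin Y W"
    using W(1) V(1) by (simp add: openin_open_subtopology)
  then have "closedin Y (topspace Y - W)" by blast
  moreover have "disjnt K (topspace Y - W)"
    using W(2) by (auto simp: disjnt_def)
  moreover have "completely_regular_space Y"
    using Y by (simp add: locally_compact_regular_imp_completely_regular_space)
  ultimately obtain \<psi> :: "'a \<Rightarrow> real" where \<psi>: "continuous_map Y (subtopology euclidean {0..1}) \<psi>"
    "\<psi> ` (topspace Y - W) \<subseteq> {0}" "\<psi> ` K \<subseteq> {1}"
    using Urysohn_completely_regular_compact_closed[OF zero_le_one _ K] by metis
  show thesis
  proof
    show "continuous_map Y euclideanreal \<psi>" "\<And>x. x \<in> topspace Y \<Longrightarrow> 0 \<le> \<psi> x \<and> \<psi> x \<le> 1"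
      using \<psi>(1) by (auto simp: continuous_map_in_subtopology)
    show "\<psi> x = 1" if "x \<in> K" for x
      using \<psi>(3) that by blast
    show "\<psi> x = 0" if "x \<in> topspace Y" "x \<notin> L" for x
      using \<psi>(2) W(3) that by blast
    show "compactin Y L" "L \<subseteq> V"
      using L by (auto simp: compactin_subtopology)
  qed
qed

context usc_banach_bundle
begin

lemma Cc_section: "s \<in> Cc_sections B U \<Longrightarrow> s \<in> continuous_sections B"
  by (simp add: Cc_sections_def)

lemma Cc_mono: "U \<subseteq> V \<Longrightarrow> Cc_sections B U \<subseteq> Cc_sections B V"
  by (auto simp: Cc_sections_def)

lemma compact_support: "s \<in> Cc_sections B U \<Longrightarrow> compactin (base B) (section_support B s)"
  by (simp add: Cc_sections_def)

lemma nonzero_in_support: "\<lbrakk>x \<in> pts; s x \<noteq> \<zero>\<^bsub>fib B x\<^esub>\<rbrakk> \<Longrightarrow> x \<in> section_support B s"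
  unfolding section_support_def
  using closure_of_subset[of "{x \<in> pts. s x \<noteq> \<zero>\<^bsub>fib B x\<^esub>}" "base B"] by blast

lemma Cc_sectionI:
  assumes s: "s \<in> continuous_sections B" and K: "compactin (base B) K" "K \<subseteq> U"
    and zero: "\<And>x. \<lbrakk>x \<in> pts; x \<notin> K\<rbrakk> \<Longrightarrow> s x = \<zero>\<^bsub>fib B x\<^esub>"
  shows "s \<in> Cc_sections B U"
proof -
  have "section_support B s \<subseteq> K"
    unfolding section_support_def using zero compactin_imp_closedin[OF Hausdorff_base K(1)]
    by (intro closure_of_minimal) auto
  moreover from this have "compactin (base B) (section_support B s)"
    by (intro closed_compactin[OF K(1)]) (auto simp: section_support_def)
  ultimately show ?thesis
    using s K(2) by (auto simp: Cc_sections_def)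
qed

text \<open>
  The open sets where the norm of \<open>s\<close> is below a natural number cover the compact support.
  Boundedness makes the supremum in \<^const>\<open>sup_norm\<close> meaningful.
\<close>

lemma compact_support_bounded:
  assumes s: "s \<in> Cc_sections B pts"
  shows "\<exists>m. \<forall>x\<in>pts. nrm (fib B x) (s x) \<le> m"
proof -
  define Lev where "Lev n = {x \<in> pts. nrm (fib B x) (s x) < real n}" for n
  have "section_support B s \<subseteq> \<Union>(range Lev)"
  proof
    fix x assume "x \<in> section_support B s"
    then have "x \<in> pts"
      using s by (auto simp: Cc_sections_def)
    moreover obtain n where "nrm (fib B x) (s x) < real n"
      using reals_Archimedean2 by blast
    ultimately show "x \<in> \<Union>(range Lev)"
      unfolding Lev_def by blast
  qed
  moreover have "openin (base B) U" if "U \<in> range Lev" for U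
    using that open_norm_section_less[OF Cc_section[OF s]] unfolding Lev_def by auto
  ultimately obtain \<F> where \<F>: "finite \<F>" "\<F> \<subseteq> range Lev" "section_support B s \<subseteq> \<Union>\<F>"
    using compactinD[OF compact_support[OF s], of "range Lev"] by blast
  then obtain J where J: "finite J" "\<F> = Lev ` J"
    by (meson finite_subset_image)
  have "nrm (fib B x) (s x) \<le> real (Max (insert 0 J))" if x: "x \<in> pts" for x
  proof (cases "s x = \<zero>\<^bsub>fib B x\<^esub>")
    case True
    then show ?thesis
      using normed_module.nrm_eq_0_iff[OF normed_fib[OF x] section_in_fib[OF Cc_section[OF s] x]]
      by simp
  next
    case False
    then obtain n where n: "n \<in> J" "x \<in> Lev n"
      using nonzero_in_support[of x s] x \<F>(3) J(2) by auto
    then have "real n \<le> real (Max (insert 0 J))"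
      using J(1) by simp
    then show ?thesis
      using n(2) unfolding Lev_def by simp
  qed
  then show ?thesis by blast
qed

lemma nrm_le_sup_norm:
  assumes "s \<in> Cc_sections B pts" "x \<in> pts"
  shows "nrm (fib B x) (s x) \<le> sup_norm B s"
proof -
  obtain m where "\<forall>x\<in>pts. nrm (fib B x) (s x) \<le> m"
    using compact_support_bounded[OF assms(1)] by blast
  then have "bdd_above (insert 0 ((\<lambda>x. nrm (fib B x) (s x)) ` pts))"
    by (intro bdd_aboveI[of _ "max 0 m"]) fastforce
  then show ?thesis
    unfolding sup_norm_def using assms(2) by (intro cSup_upper) auto
qed

lemma sup_norm_le:
  assumes "0 \<le> c" "\<And>x. x \<in> pts \<Longrightarrow> nrm (fib B x) (s x) \<le> c"
  shows "sup_norm B s \<le> c"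
  unfolding sup_norm_def using assms by (intro cSup_least) auto

lemma C0_section: "s \<in> C0_sections B \<Longrightarrow> s \<in> continuous_sections B"
  by (simp add: C0_sections_def)

text \<open>
  The set \<open>K\<close> where \<open>\<epsilon> \<le> \<parallel>s x\<parallel>\<close> is closed by upper semicontinuity, hence compact, and
  is contained in \<open>V\<close>; cutting \<open>s\<close> off outside \<open>K\<close> changes it by less than \<open>\<epsilon>\<close>.  With \<open>V\<close> the
  whole space this yields surjectivity of the isomorphism, with smaller \<open>V\<close> localizability.
\<close>

lemma Cc_approximation:
  assumes lc: "locally_compact_space (base B)"
    and s: "s \<in> C0_sections B" and V: "openin (base B) V"
    and zero: "\<And>x. \<lbrakk>x \<in> pts; x \<notin> V\<rbrakk> \<Longrightarrow> s x = \<zero>\<^bsub>fib B x\<^esub>" and "0 < \<epsilon>"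
  obtains t where "t \<in> Cc_sections B V" "\<And>x. x \<in> pts \<Longrightarrow> norm_dist (fib B x) (t x) (s x) \<le> \<epsilon>"
proof -
  define K where "K = {x \<in> pts. \<epsilon> \<le> nrm (fib B x) (s x)}"
  have "K = pts - {x \<in> pts. nrm (fib B x) (s x) < \<epsilon>}"
    unfolding K_def by auto
  then have closed: "closedin (base B) K"
    using open_norm_section_less[OF C0_section[OF s]] by auto
  obtain K' where K': "compactin (base B) K'" "\<And>x. x \<in> pts - K' \<Longrightarrow> nrm (fib B x) (s x) < \<epsilon>"
    using s \<open>0 < \<epsilon>\<close> unfolding C0_sections_def by blast
  have "K \<subseteq> K'"
    unfolding K_def using K'(2) by force
  then have K: "compactin (base B) K"
    using closed_compactin[OF K'(1) _ closed] by blast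
  have "K \<subseteq> V"
  proof
    fix x assume x: "x \<in> K"
    then have "x \<in> pts" by (simp add: K_def)
    with x show "x \<in> V"
      using zero[of x] normed_module.nrm_zero[OF normed_fib[of x]] \<open>0 < \<epsilon>\<close>
      by (cases "x \<in> V") (auto simp: K_def)
  qed
  then obtain \<phi> :: "'x \<Rightarrow> real" and L where \<phi>: "continuous_map (base B) euclideanreal \<phi>"
    "\<And>x. x \<in> pts \<Longrightarrow> 0 \<le> \<phi> x \<and> \<phi> x \<le> 1" "\<And>x. x \<in> K \<Longrightarrow> \<phi> x = 1"
    and L: "compactin (base B) L" "L \<subseteq> V" "\<And>x. \<lbrakk>x \<in> pts; x \<notin> L\<rbrakk> \<Longrightarrow> \<phi> x = 0"
    using compact_cutoff[OF lc Hausdorff_base K V] by metis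
  define t where "t = (\<lambda>x\<in>pts. complex_of_real (\<phi> x) \<odot>\<^bsub>fib B x\<^esub> s x)"
  have dist: "norm_dist (fib B x) (t x) (s x) = (1 - \<phi> x) * nrm (fib B x) (s x)"
    and t_zero: "\<phi> x = 0 \<Longrightarrow> t x = \<zero>\<^bsub>fib B x\<^esub>" if "x \<in> pts" for x
  proof -
    interpret F: normed_module "fib B x" using normed_fib[OF that] .
    have sx: "s x \<in> carrier (fib B x)" using section_in_fib[OF C0_section[OF s] that] .
    have one: "1 \<odot>\<^bsub>fib B x\<^esub> s x = s x" and "0 \<odot>\<^bsub>fib B x\<^esub> s x = \<zero>\<^bsub>fib B x\<^esub>"
      using F.smult_one[OF sx] F.smult_l_null[OF sx] by (simp_all add: ring_of_type_algebra_def)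
    then show "\<phi> x = 0 \<Longrightarrow> t x = \<zero>\<^bsub>fib B x\<^esub>"
      using that by (simp add: t_def)
    have tx: "t x \<in> carrier (fib B x)"
      using sx that by (simp add: t_def)
    have "s x \<ominus>\<^bsub>fib B x\<^esub> t x = complex_of_real (1 - \<phi> x) \<odot>\<^bsub>fib B x\<^esub> s x"
      using F.smult_diff_left[OF sx, of 1 "complex_of_real (\<phi> x)"] that one by (simp add: t_def)
    then have "norm_dist (fib B x) (s x) (t x) = cmod (complex_of_real (1 - \<phi> x)) * nrm (fib B x) (s x)"
      unfolding F.norm_dist_eq[OF sx tx] using F.nrm_smult[OF sx] by simp
    then show "norm_dist (fib B x) (t x) (s x) = (1 - \<phi> x) * nrm (fib B x) (s x)"
      using \<phi>(2)[OF that] unfolding norm_of_real by (simp add: F.metric.commute[of "t x"])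
  qed
  show thesis
  proof
    show "t \<in> Cc_sections B V"
      using scalar_function_section[OF \<phi>(1) C0_section[OF s]] L t_zero
      by (intro Cc_sectionI[of t L]) (auto simp: t_def)
    fix x assume x: "x \<in> pts"
    show "norm_dist (fib B x) (t x) (s x) \<le> \<epsilon>"
    proof (cases "x \<in> K")
      case True
      then show ?thesis using dist[OF x] \<phi>(3) \<open>0 < \<epsilon>\<close> by simp
    next
      case False
      then have "nrm (fib B x) (s x) \<le> \<epsilon>" using x by (auto simp: K_def)
      moreover have "0 \<le> nrm (fib B x) (s x)"
        using normed_module.nrm_nonneg[OF normed_fib[OF x]] section_in_fib[OF C0_section[OF s] x] by blast
      ultimately show ?thesis
        using dist[OF x] \<phi>(2)[OF x] mult_mono[of "1 - \<phi> x" 1 "nrm (fib B x) (s x)" \<epsilon>] by simp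
    qed
  qed
qed

end

locale locally_compact_cstar_bundle = usc_banach_bundle B
  for B :: "('x, 'e, 'm) fibrewise_bundle_scheme" +
  assumes cstar_bundle: "cstar_bundle B"
begin

lemma locally_compact_base: "locally_compact_space (base B)"
  and continuous_mult: "continuous_map (fibre_product B) (total B) (\<lambda>(e, f). e \<otimes>\<^bsub>fib B (proj B e)\<^esub> f)"
  and continuous_star: "continuous_map (total B) (total B) (\<lambda>e. star (fib B (proj B e)) e)"
  using cstar_bundle unfolding cstar_bundle_def by blast+

lemma cstar_fib: "x \<in> pts \<Longrightarrow> normed_cstar_algebra (fib B x)"
  using cstar_bundle unfolding cstar_bundle_def normed_cstar_algebra_def by blast

abbreviation Cc :: "('x \<Rightarrow> 'e) set" where "Cc \<equiv> Cc_sections B pts"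

abbreviation conv :: "('x \<Rightarrow> 'e) star_alg" where "conv \<equiv> convolution_algebra B"

lemma carrier_conv [simp]: "carrier conv = Cc"
  by (simp add: convolution_algebra_def pointwise_algebra_def)

lemma conv_apply:
  assumes "x \<in> pts"
  shows "(s \<oplus>\<^bsub>conv\<^esub> t) x = s x \<oplus>\<^bsub>fib B x\<^esub> t x" "(z \<odot>\<^bsub>conv\<^esub> s) x = z \<odot>\<^bsub>fib B x\<^esub> s x"
    "(s \<otimes>\<^bsub>conv\<^esub> t) x = s x \<otimes>\<^bsub>fib B x\<^esub> t x" "star conv s x = star (fib B x) (s x)"
    "\<zero>\<^bsub>conv\<^esub> x = \<zero>\<^bsub>fib B x\<^esub>"
  using assms by (simp_all add: convolution_algebra_def pointwise_algebra_def)

lemma mult_section: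
  assumes "s \<in> continuous_sections B" "t \<in> continuous_sections B"
  shows "s \<otimes>\<^bsub>conv\<^esub> t \<in> continuous_sections B"
proof -
  have "(\<lambda>x\<in>pts. s x \<otimes>\<^bsub>fib B x\<^esub> t x) \<in> continuous_sections B"
  proof (rule restrict_continuous_section)
    show "continuous_map (base B) (total B) (\<lambda>x. s x \<otimes>\<^bsub>fib B x\<^esub> t x)"
      using assms by (intro continuous_fibrewise_binop[where op = "\<lambda>x. (\<otimes>\<^bsub>fib B x\<^esub>)"]
        continuous_mult continuous_section) (auto simp: proj_section)
    fix x assume x: "x \<in> pts"
    then interpret normed_cstar_algebra "fib B x" using cstar_fib by blast
    show "s x \<otimes>\<^bsub>fib B x\<^esub> t x \<in> carrier (fib B x)"
      using assms x section_in_fib mult_closed by simp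
  qed
  then show ?thesis by (simp add: convolution_algebra_def pointwise_algebra_def)
qed

lemma star_section:
  assumes "s \<in> continuous_sections B"
  shows "star conv s \<in> continuous_sections B"
proof -
  have "(\<lambda>x\<in>pts. star (fib B x) (s x)) \<in> continuous_sections B"
  proof (rule restrict_continuous_section)
    show "continuous_map (base B) (total B) (\<lambda>x. star (fib B x) (s x))"
      using continuous_map_compose[OF continuous_section[OF assms] continuous_star]
      by (rule continuous_map_eq) (use assms proj_section in auto)
    fix x assume x: "x \<in> pts"
    then interpret normed_cstar_algebra "fib B x" using cstar_fib by blast
    show "star (fib B x) (s x) \<in> carrier (fib B x)"
      using assms x section_in_fib star_closed by simp
  qed
  then show ?thesis by (simp add: convolution_algebra_def pointwise_algebra_def)
qed

lemma Cc_supported_by: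
  assumes s: "s \<in> Cc" and t: "t \<in> continuous_sections B"
    and zero: "\<And>x. \<lbrakk>x \<in> pts; s x = \<zero>\<^bsub>fib B x\<^esub>\<rbrakk> \<Longrightarrow> t x = \<zero>\<^bsub>fib B x\<^esub>"
  shows "t \<in> Cc"
  using compact_support[OF s] nonzero_in_support zero
  by (intro Cc_sectionI[OF t, of "section_support B s"]) (auto dest: compactin_subset_topspace)

lemma Cc_zero: "\<zero>\<^bsub>conv\<^esub> \<in> Cc"
  using zero_section by (intro Cc_sectionI[of _ "{}"]) (auto simp: convolution_algebra_def pointwise_algebra_def)

lemma Cc_add:
  assumes s: "s \<in> Cc" and t: "t \<in> Cc"
  shows "s \<oplus>\<^bsub>conv\<^esub> t \<in> Cc"
proof (rule Cc_sectionI)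
  show "s \<oplus>\<^bsub>conv\<^esub> t \<in> continuous_sections B"
    using add_section[OF Cc_section[OF s] Cc_section[OF t]]
    by (simp add: convolution_algebra_def pointwise_algebra_def)
  show c: "compactin (base B) (section_support B s \<union> section_support B t)"
    using s t by (intro compactin_Un compact_support)
  show "section_support B s \<union> section_support B t \<subseteq> pts"
    using compactin_subset_topspace[OF c] .
  fix x assume x: "x \<in> pts" "x \<notin> section_support B s \<union> section_support B t"
  then have zeros: "s x = \<zero>\<^bsub>fib B x\<^esub>" "t x = \<zero>\<^bsub>fib B x\<^esub>"
    using nonzero_in_support by auto
  interpret normed_module "fib B x" using normed_fib[OF x(1)] .
  from zeros show "(s \<oplus>\<^bsub>conv\<^esub> t) x = \<zero>\<^bsub>fib B x\<^esub>"
    using x by (simp add: conv_apply)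
qed

lemma Cc_smult: assumes s: "s \<in> Cc" shows "z \<odot>\<^bsub>conv\<^esub> s \<in> Cc"
proof (rule Cc_supported_by[OF s])
  show "z \<odot>\<^bsub>conv\<^esub> s \<in> continuous_sections B"
    using smult_section[OF Cc_section[OF s]] by (simp add: convolution_algebra_def pointwise_algebra_def)
  fix x assume x: "x \<in> pts" "s x = \<zero>\<^bsub>fib B x\<^esub>"
  interpret normed_module "fib B x" using normed_fib[OF x(1)] .
  show "(z \<odot>\<^bsub>conv\<^esub> s) x = \<zero>\<^bsub>fib B x\<^esub>"
    using x by (simp add: conv_apply)
qed

lemma Cc_mult: assumes s: "s \<in> Cc" and t: "t \<in> Cc" shows "s \<otimes>\<^bsub>conv\<^esub> t \<in> Cc"
proof (rule Cc_supported_by[OF s mult_section[OF Cc_section[OF s] Cc_section[OF t]]])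
  fix x assume x: "x \<in> pts" "s x = \<zero>\<^bsub>fib B x\<^esub>"
  interpret normed_cstar_algebra "fib B x" using cstar_fib[OF x(1)] .
  have "\<zero>\<^bsub>fib B x\<^esub> \<otimes>\<^bsub>fib B x\<^esub> t x = \<zero>\<^bsub>fib B x\<^esub>"
    using nrm_mult[of "\<zero>\<^bsub>fib B x\<^esub>" "t x"] section_in_fib[OF Cc_section[OF t] x(1)] mult_closed
      nrm_nonneg[of "\<zero>\<^bsub>fib B x\<^esub> \<otimes>\<^bsub>fib B x\<^esub> t x"]
      nrm_eq_0_iff[of "\<zero>\<^bsub>fib B x\<^esub> \<otimes>\<^bsub>fib B x\<^esub> t x"] by simp
  then show "(s \<otimes>\<^bsub>conv\<^esub> t) x = \<zero>\<^bsub>fib B x\<^esub>"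
    using x by (simp add: conv_apply)
qed

lemma Cc_star: assumes s: "s \<in> Cc" shows "star conv s \<in> Cc"
proof (rule Cc_supported_by[OF s star_section[OF Cc_section[OF s]]])
  fix x assume x: "x \<in> pts" "s x = \<zero>\<^bsub>fib B x\<^esub>"
  interpret normed_cstar_algebra "fib B x" using cstar_fib[OF x(1)] .
  have "star (fib B x) \<zero>\<^bsub>fib B x\<^esub> = \<zero>\<^bsub>fib B x\<^esub>"
    using nrm_star[of "\<zero>\<^bsub>fib B x\<^esub>"] nrm_eq_0_iff[of "star (fib B x) \<zero>\<^bsub>fib B x\<^esub>"]
      star_closed by simp
  then show "star conv s x = \<zero>\<^bsub>fib B x\<^esub>"
    using x by (simp add: conv_apply)
qed

end

section \<open>Evaluation on a compatible completion\<close>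

locale compatible_completion_of_bundle = locally_compact_cstar_bundle B
  for B :: "('x, 'e, 'm) fibrewise_bundle_scheme" +
  fixes A :: "('a, 'n) normed_star_alg_scheme" and j :: "('x \<Rightarrow> 'e) \<Rightarrow> 'a"
  assumes completion: "compatible_completion B A j"

sublocale compatible_completion_of_bundle \<subseteq> A: normed_cstar_algebra A
  using completion unfolding compatible_completion_def cstar_completion_def
  by unfold_locales blast

context compatible_completion_of_bundle
begin

lemma j_hom: "star_hom conv A j"
  and closure_range_j: "norm_topology A closure_of (j ` Cc) = carrier A"
  using completion unfolding compatible_completion_def cstar_completion_def carrier_conv by blast+

text \<open>
  The whole base space is open, so compatibility already forces the norm on the convolution
  algebra to be the supremum norm.
\<close>

lemma nrm_j: "s \<in> Cc \<Longrightarrow> nrm A (j s) = sup_norm B s"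
  using completion
  unfolding compatible_completion_def cstar_completion_def compatible_norm_def carrier_conv
  by (metis openin_topspace)

lemma j_closed [simp]: "s \<in> Cc \<Longrightarrow> j s \<in> carrier A"
  and j_add: "\<lbrakk>s \<in> Cc; t \<in> Cc\<rbrakk> \<Longrightarrow> j (s \<oplus>\<^bsub>conv\<^esub> t) = j s \<oplus>\<^bsub>A\<^esub> j t"
  and j_smult: "s \<in> Cc \<Longrightarrow> j (z \<odot>\<^bsub>conv\<^esub> s) = z \<odot>\<^bsub>A\<^esub> j s"
  and j_mult: "\<lbrakk>s \<in> Cc; t \<in> Cc\<rbrakk> \<Longrightarrow> j (s \<otimes>\<^bsub>conv\<^esub> t) = j s \<otimes>\<^bsub>A\<^esub> j t"
  and j_star: "s \<in> Cc \<Longrightarrow> j (star conv s) = star A (j s)"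
  using j_hom unfolding star_hom_def complex_linear_def carrier_conv by auto

lemma j_zero: "j \<zero>\<^bsub>conv\<^esub> = \<zero>\<^bsub>A\<^esub>"
proof -
  have "nrm A (j \<zero>\<^bsub>conv\<^esub>) \<le> 0"
    unfolding nrm_j[OF Cc_zero]
    by (rule sup_norm_le) (simp_all add: conv_apply normed_module.nrm_zero[OF normed_fib])
  then show ?thesis
    using A.nrm_nonneg[OF j_closed[OF Cc_zero]] A.nrm_eq_0_iff[OF j_closed[OF Cc_zero]] by simp
qed

lemma Cc_in_fib: "\<lbrakk>s \<in> Cc; x \<in> pts\<rbrakk> \<Longrightarrow> s x \<in> carrier (fib B x)"
  by (rule section_in_fib[OF Cc_section])

lemma dense: "\<lbrakk>a \<in> carrier A; 0 < \<epsilon>\<rbrakk> \<Longrightarrow> \<exists>s\<in>Cc. norm_dist A (j s) a < \<epsilon>"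
  using closure_range_j A.in_norm_closure_iff[of a "j ` Cc"] by blast

text \<open>
  Together with the two lemmas that follow, this says that the distance of \<open>j s\<close> and \<open>j t\<close> is the
  supremum of the fibrewise distances of \<open>s\<close> and \<open>t\<close>.
\<close>

lemma j_diff:
  assumes s: "s \<in> Cc" and t: "t \<in> Cc"
  obtains u where "u \<in> Cc" "norm_dist A (j s) (j t) = sup_norm B u"
    "\<And>x. x \<in> pts \<Longrightarrow> nrm (fib B x) (u x) = norm_dist (fib B x) (s x) (t x)"
proof
  define u where "u = s \<oplus>\<^bsub>conv\<^esub> ((-1) \<odot>\<^bsub>conv\<^esub> t)"
  show u: "u \<in> Cc"
    unfolding u_def by (intro Cc_add Cc_smult s t)
  have "j u = j s \<ominus>\<^bsub>A\<^esub> j t"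
    unfolding u_def using s t by (simp add: j_add j_smult Cc_smult A.smult_minus_one a_minus_def)
  then show "norm_dist A (j s) (j t) = sup_norm B u"
    using nrm_j[OF u] s t by (simp add: A.norm_dist_eq)
  fix x assume x: "x \<in> pts"
  interpret F: normed_module "fib B x" using normed_fib[OF x] .
  have "u x = s x \<ominus>\<^bsub>fib B x\<^esub> t x"
    unfolding u_def using Cc_in_fib[OF t x] x by (simp add: conv_apply F.smult_minus_one a_minus_def)
  then show "nrm (fib B x) (u x) = norm_dist (fib B x) (s x) (t x)"
    using Cc_in_fib[OF s x] Cc_in_fib[OF t x] by (simp add: F.norm_dist_eq)
qed

lemma norm_dist_section_le:
  assumes "s \<in> Cc" "t \<in> Cc" "x \<in> pts"
  shows "norm_dist (fib B x) (s x) (t x) \<le> norm_dist A (j s) (j t)"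
  using j_diff[OF assms(1,2)] nrm_le_sup_norm assms(3) by metis

lemma norm_dist_j_le:
  assumes "s \<in> Cc" "t \<in> Cc" "0 \<le> c" "\<And>x. x \<in> pts \<Longrightarrow> norm_dist (fib B x) (s x) (t x) \<le> c"
  shows "norm_dist A (j s) (j t) \<le> c"
  using j_diff[OF assms(1,2)] sup_norm_le[OF assms(3)] assms(4) by metis

text \<open>
  The evaluation at \<open>x\<close>, characterized by inequalities instead of as a continuous extension:
  algebraic identities then follow from approximation (\<open>ev_eqI\<close>) without any topology.  That it
  agrees with \<^const>\<open>eval_at\<close> is shown in \<open>eval_at_eq_ev\<close>.
\<close>

definition ev :: "'x \<Rightarrow> 'a \<Rightarrow> 'e" where
  "ev x a = (SOME e. e \<in> carrier (fib B x) \<and>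
     (\<forall>s\<in>Cc. norm_dist (fib B x) (s x) e \<le> norm_dist A (j s) a))"

lemma ev_exists:
  assumes "x \<in> pts" "a \<in> carrier A"
  shows "ev x a \<in> carrier (fib B x) \<and>
    (\<forall>s\<in>Cc. norm_dist (fib B x) (s x) (ev x a) \<le> norm_dist A (j s) a)"
proof -
  have "\<exists>e\<in>carrier (fib B x). \<forall>s\<in>Cc. norm_dist (fib B x) (s x) e \<le> norm_dist A (j s) a"
    using assms Cc_in_fib norm_dist_section_le dense
    by (intro A.contraction_extension[where h = "\<lambda>s. s x"] normed_fib complete_fib) auto
  then show ?thesis
    unfolding ev_def Bex_def by (rule someI_ex)
qed

lemma ev_closed [simp]: "\<lbrakk>x \<in> pts; a \<in> carrier A\<rbrakk> \<Longrightarrow> ev x a \<in> carrier (fib B x)"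
  and ev_near: "\<lbrakk>x \<in> pts; a \<in> carrier A; s \<in> Cc\<rbrakk> \<Longrightarrow>
    norm_dist (fib B x) (s x) (ev x a) \<le> norm_dist A (j s) a"
  using ev_exists by blast+

lemma ev_eqI:
  assumes x: "x \<in> pts" and a: "a \<in> carrier A" and e: "e \<in> carrier (fib B x)"
    and approx: "\<And>\<epsilon>. 0 < \<epsilon> \<Longrightarrow>
      \<exists>s\<in>Cc. norm_dist A (j s) a \<le> \<epsilon> \<and> norm_dist (fib B x) (s x) e \<le> \<epsilon>"
  shows "ev x a = e"
proof -
  interpret F: normed_module "fib B x" using normed_fib[OF x] .
  have "norm_dist (fib B x) (ev x a) e \<le> 0 + \<epsilon>" if "0 < \<epsilon>" for \<epsilon>
  proof -
    obtain s where s: "s \<in> Cc" "norm_dist A (j s) a \<le> \<epsilon> / 2" "norm_dist (fib B x) (s x) e \<le> \<epsilon> / 2"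
      using approx[OF half_gt_zero[OF \<open>0 < \<epsilon>\<close>]] by blast
    show ?thesis
      using F.metric.triangle[of "ev x a" "s x" e] F.metric.commute[of "ev x a" "s x"]
        ev_near[OF x a s(1)] s Cc_in_fib[OF s(1) x] x a e by simp
  qed
  then have "norm_dist (fib B x) (ev x a) e \<le> 0"
    by (rule field_le_epsilon)
  then show ?thesis
    using F.metric.zero[of "ev x a" e] F.metric.nonneg[of "ev x a" e] x a e by simp
qed

lemma ev_j: "\<lbrakk>x \<in> pts; s \<in> Cc\<rbrakk> \<Longrightarrow> ev x (j s) = s x"
proof (rule ev_eqI)
  assume x: "x \<in> pts" and s: "s \<in> Cc"
  interpret F: normed_module "fib B x" using normed_fib[OF x] .
  show "\<exists>t\<in>Cc. norm_dist A (j t) (j s) \<le> \<epsilon> \<and> norm_dist (fib B x) (t x) (s x) \<le> \<epsilon>" if "0 < \<epsilon>" for \<epsilon>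
    using s that Cc_in_fib[OF s x] by (intro bexI[of _ s]) (auto simp: A.metric.mdist_zero F.metric.mdist_zero)
qed (auto intro: Cc_in_fib)

text \<open>
  The defining inequality of the evaluation at the zero section.
\<close>

lemma nrm_ev_le: assumes "x \<in> pts" "a \<in> carrier A" shows "nrm (fib B x) (ev x a) \<le> nrm A a"
proof -
  interpret F: normed_module "fib B x" using normed_fib[OF assms(1)] .
  show ?thesis
    using ev_near[OF assms Cc_zero] assms
    by (simp add: conv_apply j_zero F.metric.commute[of "\<zero>\<^bsub>fib B x\<^esub>"]
        A.metric.commute[of "\<zero>\<^bsub>A\<^esub>"] F.norm_dist_zero A.norm_dist_zero)
qed

lemma ev_add:
  assumes x: "x \<in> pts" and a: "a \<in> carrier A" and b: "b \<in> carrier A"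
  shows "ev x (a \<oplus>\<^bsub>A\<^esub> b) = ev x a \<oplus>\<^bsub>fib B x\<^esub> ev x b"
proof (rule ev_eqI[OF x])
  interpret F: normed_module "fib B x" using normed_fib[OF x] .
  show "a \<oplus>\<^bsub>A\<^esub> b \<in> carrier A" "ev x a \<oplus>\<^bsub>fib B x\<^esub> ev x b \<in> carrier (fib B x)"
    using x a b by simp_all
  fix \<epsilon> :: real assume "0 < \<epsilon>"
  then obtain s t where s: "s \<in> Cc" "norm_dist A (j s) a < \<epsilon> / 2"
    and t: "t \<in> Cc" "norm_dist A (j t) b < \<epsilon> / 2"
    using dense[OF a, of "\<epsilon> / 2"] dense[OF b, of "\<epsilon> / 2"] by auto
  have "norm_dist A (j (s \<oplus>\<^bsub>conv\<^esub> t)) (a \<oplus>\<^bsub>A\<^esub> b) \<le> \<epsilon>"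
    using A.norm_dist_add[of "j s" "j t" a b] s t a b by (simp add: j_add)
  moreover have "norm_dist (fib B x) ((s \<oplus>\<^bsub>conv\<^esub> t) x) (ev x a \<oplus>\<^bsub>fib B x\<^esub> ev x b) \<le> \<epsilon>"
    using F.norm_dist_add[of "s x" "t x" "ev x a" "ev x b"] ev_near[OF x a s(1)] ev_near[OF x b t(1)]
      s t x a b by (simp add: conv_apply Cc_in_fib)
  ultimately show "\<exists>u\<in>Cc. norm_dist A (j u) (a \<oplus>\<^bsub>A\<^esub> b) \<le> \<epsilon> \<and>
      norm_dist (fib B x) (u x) (ev x a \<oplus>\<^bsub>fib B x\<^esub> ev x b) \<le> \<epsilon>"
    using Cc_add[OF s(1) t(1)] by blast
qed

lemma ev_smult:
  assumes x: "x \<in> pts" and a: "a \<in> carrier A"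
  shows "ev x (z \<odot>\<^bsub>A\<^esub> a) = z \<odot>\<^bsub>fib B x\<^esub> ev x a"
proof (rule ev_eqI[OF x])
  interpret F: normed_module "fib B x" using normed_fib[OF x] .
  show "z \<odot>\<^bsub>A\<^esub> a \<in> carrier A" "z \<odot>\<^bsub>fib B x\<^esub> ev x a \<in> carrier (fib B x)"
    using x a by auto
  fix \<epsilon> :: real assume "0 < \<epsilon>"
  then have "0 < \<epsilon> / (cmod z + 1)"
    by (simp add: add_nonneg_pos)
  then obtain s where s: "s \<in> Cc" "norm_dist A (j s) a < \<epsilon> / (cmod z + 1)"
    using dense[OF a] by blast
  have "cmod z * norm_dist A (j s) a \<le> (cmod z + 1) * (\<epsilon> / (cmod z + 1))"
    using s(2) by (intro mult_mono) auto
  also have "\<dots> = \<epsilon>"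
    using norm_ge_zero[of z] by (simp add: add_nonneg_eq_0_iff)
  finally have le: "cmod z * norm_dist A (j s) a \<le> \<epsilon>" .
  then have "norm_dist A (j (z \<odot>\<^bsub>conv\<^esub> s)) (z \<odot>\<^bsub>A\<^esub> a) \<le> \<epsilon>"
    using s a by (simp add: j_smult A.norm_dist_smult)
  moreover have "cmod z * norm_dist (fib B x) (s x) (ev x a) \<le> cmod z * norm_dist A (j s) a"
    using ev_near[OF x a s(1)] by (intro mult_left_mono) auto
  then have "norm_dist (fib B x) ((z \<odot>\<^bsub>conv\<^esub> s) x) (z \<odot>\<^bsub>fib B x\<^esub> ev x a) \<le> \<epsilon>"
    using le s x a by (simp add: conv_apply F.norm_dist_smult Cc_in_fib)
  ultimately show "\<exists>u\<in>Cc. norm_dist A (j u) (z \<odot>\<^bsub>A\<^esub> a) \<le> \<epsilon> \<and>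
      norm_dist (fib B x) (u x) (z \<odot>\<^bsub>fib B x\<^esub> ev x a) \<le> \<epsilon>"
    using Cc_smult[OF s(1)] by blast
qed

lemma ev_mult:
  assumes x: "x \<in> pts" and a: "a \<in> carrier A" and b: "b \<in> carrier A"
  shows "ev x (a \<otimes>\<^bsub>A\<^esub> b) = ev x a \<otimes>\<^bsub>fib B x\<^esub> ev x b"
proof (rule ev_eqI[OF x])
  interpret F: normed_cstar_algebra "fib B x" using cstar_fib[OF x] .
  show "a \<otimes>\<^bsub>A\<^esub> b \<in> carrier A" "ev x a \<otimes>\<^bsub>fib B x\<^esub> ev x b \<in> carrier (fib B x)"
    using x a b by (simp_all add: A.mult_closed F.mult_closed)
  fix \<epsilon> :: real assume "0 < \<epsilon>"
  define m where "m = nrm A a + nrm A b + 1"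
  have m: "0 < m"
    unfolding m_def using A.nrm_nonneg[OF a] A.nrm_nonneg[OF b] by simp
  define \<delta> where "\<delta> = min 1 (\<epsilon> / m)"
  have \<delta>: "0 < \<delta>" "\<delta> \<le> 1" "\<delta> * m \<le> \<epsilon>"
    using m \<open>0 < \<epsilon>\<close> by (auto simp: \<delta>_def min_def field_simps)
  obtain s t where s: "s \<in> Cc" "norm_dist A (j s) a < \<delta>" and t: "t \<in> Cc" "norm_dist A (j t) b < \<delta>"
    using dense[OF a \<delta>(1)] dense[OF b \<delta>(1)] by auto
  have "norm_dist A (j (s \<otimes>\<^bsub>conv\<^esub> t)) (a \<otimes>\<^bsub>A\<^esub> b) \<le> \<delta> * m"
    unfolding m_def j_mult[OF s(1) t(1)] using s t a b \<delta> by (intro A.norm_dist_mult) auto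
  moreover have "norm_dist (fib B x) ((s \<otimes>\<^bsub>conv\<^esub> t) x) (ev x a \<otimes>\<^bsub>fib B x\<^esub> ev x b)
      \<le> \<delta> * (nrm (fib B x) (ev x a) + nrm (fib B x) (ev x b) + 1)"
    unfolding conv_apply[OF x] using s t x a b \<delta> ev_near[OF x a s(1)] ev_near[OF x b t(1)]
    by (intro F.norm_dist_mult Cc_in_fib ev_closed) auto
  moreover have "\<delta> * (nrm (fib B x) (ev x a) + nrm (fib B x) (ev x b) + 1) \<le> \<delta> * m"
    unfolding m_def using nrm_ev_le[OF x a] nrm_ev_le[OF x b] \<delta>(1) by (intro mult_left_mono) auto
  ultimately show "\<exists>u\<in>Cc. norm_dist A (j u) (a \<otimes>\<^bsub>A\<^esub> b) \<le> \<epsilon> \<and>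
      norm_dist (fib B x) (u x) (ev x a \<otimes>\<^bsub>fib B x\<^esub> ev x b) \<le> \<epsilon>"
    using Cc_mult[OF s(1) t(1)] \<delta>(3) by (intro bexI[of _ "s \<otimes>\<^bsub>conv\<^esub> t"]) auto
qed

lemma ev_star:
  assumes x: "x \<in> pts" and a: "a \<in> carrier A"
  shows "ev x (star A a) = star (fib B x) (ev x a)"
proof (rule ev_eqI[OF x])
  interpret F: normed_cstar_algebra "fib B x" using cstar_fib[OF x] .
  show "star A a \<in> carrier A" "star (fib B x) (ev x a) \<in> carrier (fib B x)"
    using x a by (simp_all add: A.star_closed F.star_closed)
  fix \<epsilon> :: real assume "0 < \<epsilon>"
  then obtain s where s: "s \<in> Cc" "norm_dist A (j s) a < \<epsilon>"
    using dense[OF a] by blast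
  then show "\<exists>u\<in>Cc. norm_dist A (j u) (star A a) \<le> \<epsilon> \<and>
      norm_dist (fib B x) (u x) (star (fib B x) (ev x a)) \<le> \<epsilon>"
    using ev_near[OF x a s(1)] x a Cc_star[OF s(1)]
    by (intro bexI[of _ "star conv s"])
       (simp_all add: j_star conv_apply A.norm_dist_star F.norm_dist_star Cc_in_fib)
qed

text \<open>
  A converse of \<open>ev_near\<close>, resting on the norm being the supremum norm on the image of \<open>j\<close>: by
  density \<open>a\<close> may be replaced by some \<open>j s\<close>.  It gives injectivity of \<open>a \<mapsto> sec a\<close> and
  localizability.
\<close>

lemma norm_dist_j_le_ev:
  assumes t: "t \<in> Cc" and a: "a \<in> carrier A" and "0 \<le> c"
    and le: "\<And>x. x \<in> pts \<Longrightarrow> norm_dist (fib B x) (t x) (ev x a) \<le> c"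
  shows "norm_dist A (j t) a \<le> c"
proof (rule field_le_epsilon)
  fix \<epsilon> :: real assume "0 < \<epsilon>"
  then obtain s where s: "s \<in> Cc" "norm_dist A (j s) a < \<epsilon> / 2"
    using dense[OF a, of "\<epsilon> / 2"] by auto
  have "norm_dist (fib B x) (t x) (s x) \<le> c + \<epsilon> / 2" if x: "x \<in> pts" for x
  proof -
    interpret F: normed_module "fib B x" using normed_fib[OF x] .
    show ?thesis
      using F.metric.triangle[of "t x" "ev x a" "s x"] F.metric.commute[of "ev x a" "s x"] le[OF x]
        ev_near[OF x a s(1)] s Cc_in_fib[OF t x] Cc_in_fib[OF s(1) x] x a by simp
  qed
  then have "norm_dist A (j t) (j s) \<le> c + \<epsilon> / 2"
    using \<open>0 < \<epsilon>\<close> \<open>0 \<le> c\<close> t s(1) by (intro norm_dist_j_le) auto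
  then show "norm_dist A (j t) a \<le> c + \<epsilon>"
    using A.metric.triangle[of "j t" "j s" a] s t a by simp
qed

text \<open>
  The map \<^term>\<open>ev x\<close> is linear and 1-Lipschitz, and a continuous map into a Hausdorff space is
  determined by its values on the dense image of \<open>j\<close>.
\<close>

lemma eval_at_eq_ev:
  assumes x: "x \<in> pts"
  shows "eval_at B A j x = restrict (ev x) (carrier A)"
  unfolding eval_at_def carrier_conv
proof (rule the_equality)
  interpret F: normed_module "fib B x" using normed_fib[OF x] .
  have lip: "norm_dist (fib B x) (ev x a) (ev x b) \<le> norm_dist A a b"
    if "a \<in> carrier A" "b \<in> carrier A" for a b
  proof -
    have "ev x (a \<ominus>\<^bsub>A\<^esub> b) = ev x a \<ominus>\<^bsub>fib B x\<^esub> ev x b"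
      using that x ev_add[OF x, of a "(-1) \<odot>\<^bsub>A\<^esub> b"] ev_smult[OF x, of b "-1"]
      by (simp add: A.smult_minus_one F.smult_minus_one a_minus_def)
    then show ?thesis
      using nrm_ev_le[OF x, of "a \<ominus>\<^bsub>A\<^esub> b"] that x by (simp add: A.norm_dist_eq F.norm_dist_eq)
  qed
  have cont: "continuous_map (norm_topology A) (norm_topology (fib B x)) (restrict (ev x) (carrier A))"
    unfolding norm_topology_def A.metric.metric_continuous_map[OF F.norm_dist_metric]
  proof (intro conjI ballI allI impI)
    show "restrict (ev x) (carrier A) ` carrier A \<subseteq> carrier (fib B x)"
      using x by auto
    fix a \<epsilon> assume "a \<in> carrier A" "0 < (\<epsilon> :: real)"
    then show "\<exists>\<delta>>0. \<forall>b. b \<in> carrier A \<and> norm_dist A a b < \<delta> \<longrightarrow>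
        norm_dist (fib B x) (restrict (ev x) (carrier A) a) (restrict (ev x) (carrier A) b) < \<epsilon>"
      using lip by (intro exI[of _ \<epsilon>]) (auto intro: order.strict_trans1)
  qed
  show "restrict (ev x) (carrier A) \<in> extensional (carrier A) \<and>
      complex_linear A (fib B x) (restrict (ev x) (carrier A)) \<and>
      continuous_map (norm_topology A) (norm_topology (fib B x)) (restrict (ev x) (carrier A)) \<and>
      (\<forall>s\<in>Cc. restrict (ev x) (carrier A) (j s) = s x)"
    using cont x by (auto simp: complex_linear_def ev_add ev_smult ev_j)
  fix f assume f: "f \<in> extensional (carrier A) \<and> complex_linear A (fib B x) f \<and>
      continuous_map (norm_topology A) (norm_topology (fib B x)) f \<and> (\<forall>s\<in>Cc. f (j s) = s x)"
  show "f = restrict (ev x) (carrier A)"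
  proof (rule extensionalityI[of _ "carrier A"])
    fix a assume "a \<in> carrier A"
    then have "a \<in> norm_topology A closure_of (j ` Cc)"
      by (simp add: closure_range_j)
    moreover have "Hausdorff_space (norm_topology (fib B x))"
      unfolding norm_topology_def by (rule F.metric.Hausdorff_space_mtopology)
    ultimately show "f a = restrict (ev x) (carrier A) a"
      using f x by (elim forall_in_closure_of_eq[OF _ _ _ cont]) (auto simp: ev_j)
  qed (use f in auto)
qed

section \<open>Identification with the sections vanishing at infinity\<close>

definition sec :: "'a \<Rightarrow> 'x \<Rightarrow> 'e" where
  "sec a = (\<lambda>x\<in>pts. ev x a)"

text \<open>
  Choose \<open>s\<close> in \<open>Cc\<close> with \<open>j s\<close> close to \<open>a\<close>.  Then \<open>s\<close> is uniformly close to \<^term>\<open>sec a\<close>,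
  which gives continuity by local approximation, and smallness of \<^term>\<open>sec a\<close> off the compact
  support of \<open>s\<close>.
\<close>

lemma sec_in_C0:
  assumes a: "a \<in> carrier A"
  shows "sec a \<in> C0_sections B"
proof -
  have "continuous_map (base B) (total B) (\<lambda>x. ev x a)"
  proof (rule continuous_if_locally_approximable)
    fix x \<epsilon> assume x: "x \<in> pts" and "0 < (\<epsilon> :: real)"
    then obtain s where s: "s \<in> Cc" "norm_dist A (j s) a < \<epsilon>"
      using dense[OF a] by blast
    then have "\<forall>y\<in>pts. norm_dist (fib B y) (s y) (ev y a) < \<epsilon>"
      using ev_near[OF _ a s(1)] by (meson order.strict_trans1)
    with x show "\<exists>t U. t \<in> continuous_sections B \<and> openin (base B) U \<and> x \<in> U \<and>
        (\<forall>y\<in>U. norm_dist (fib B y) (t y) (ev y a) < \<epsilon>)"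
      using Cc_section[OF s(1)] by (intro exI[of _ s] exI[of _ pts]) auto
  qed (use a in auto)
  then have "sec a \<in> continuous_sections B"
    unfolding sec_def by (rule restrict_continuous_section) (use a in auto)
  moreover have "\<exists>K. compactin (base B) K \<and> (\<forall>x\<in>pts - K. nrm (fib B x) (sec a x) < \<epsilon>)"
    if "0 < \<epsilon>" for \<epsilon>
  proof -
    obtain s where s: "s \<in> Cc" "norm_dist A (j s) a < \<epsilon>"
      using dense[OF a \<open>0 < \<epsilon>\<close>] by blast
    have "nrm (fib B x) (sec a x) < \<epsilon>" if x: "x \<in> pts" "x \<notin> section_support B s" for x
    proof -
      interpret F: normed_module "fib B x" using normed_fib[OF x(1)] .
      have "s x = \<zero>\<^bsub>fib B x\<^esub>"
        using nonzero_in_support x by blast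
      then show ?thesis
        using ev_near[OF x(1) a s(1)] s(2) x(1) a F.norm_dist_zero[of "ev x a"]
        by (simp add: sec_def F.metric.commute[of "\<zero>\<^bsub>fib B x\<^esub>"])
    qed
    then show ?thesis
      using compact_support[OF s(1)] by blast
  qed
  ultimately show ?thesis
    unfolding C0_sections_def by blast
qed

lemma C0_algebra_apply:
  "carrier (C0_algebra B) = C0_sections B"
  "s \<oplus>\<^bsub>C0_algebra B\<^esub> t = (\<lambda>x\<in>pts. s x \<oplus>\<^bsub>fib B x\<^esub> t x)"
  "z \<odot>\<^bsub>C0_algebra B\<^esub> s = (\<lambda>x\<in>pts. z \<odot>\<^bsub>fib B x\<^esub> s x)"
  "s \<otimes>\<^bsub>C0_algebra B\<^esub> t = (\<lambda>x\<in>pts. s x \<otimes>\<^bsub>fib B x\<^esub> t x)"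
  "star (C0_algebra B) s = (\<lambda>x\<in>pts. star (fib B x) (s x))"
  by (simp_all add: C0_algebra_def pointwise_algebra_def star_alg.defs normed_star_alg.defs)

lemma star_hom_sec: "star_hom A (C0_algebra B) sec"
  unfolding star_hom_def complex_linear_def C0_algebra_apply
  by (auto simp: sec_in_C0[unfolded sec_def] sec_def ev_add ev_smult ev_mult ev_star cong: restrict_cong)

lemma inj_on_sec: "inj_on sec (carrier A)"
proof (rule inj_onI)
  fix a b assume a: "a \<in> carrier A" and b: "b \<in> carrier A" and eq: "sec a = sec b"
  have ev: "ev x a = ev x b" if "x \<in> pts" for x
    using fun_cong[OF eq, of x] that by (simp add: sec_def)
  have "norm_dist A a b \<le> 0 + \<epsilon>" if "0 < \<epsilon>" for \<epsilon>
  proof -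
    obtain s where s: "s \<in> Cc" "norm_dist A (j s) a < \<epsilon> / 2"
      using dense[OF a half_gt_zero[OF \<open>0 < \<epsilon>\<close>]] by blast
    have "norm_dist A (j s) b \<le> norm_dist A (j s) a"
      using ev_near[OF _ a s(1)] s(1) b by (intro norm_dist_j_le_ev) (auto simp: ev)
    then show ?thesis
      using A.metric.triangle[of a "j s" b] A.metric.commute[of a "j s"] s a b by simp
  qed
  then have "norm_dist A a b \<le> 0"
    by (rule field_le_epsilon)
  then show "a = b"
    using A.metric.zero[OF a b] A.metric.nonneg[of a b] by simp
qed

text \<open>
  Approximations \<open>u n\<close> of \<open>s\<close> with compact support are uniformly Cauchy, so that \<open>j (u n)\<close> is
  Cauchy and converges by completeness of \<open>A\<close>; the limit evaluates to \<open>s\<close>.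
\<close>

lemma sec_surj:
  assumes s: "s \<in> C0_sections B"
  shows "\<exists>a\<in>carrier A. sec a = s"
proof -
  have s_fib: "s x \<in> carrier (fib B x)" if "x \<in> pts" for x
    using section_in_fib[OF C0_section[OF s] that] .
  have "\<exists>t\<in>Cc. \<forall>x\<in>pts. norm_dist (fib B x) (t x) (s x) \<le> inverse (Suc n)" for n
    using Cc_approximation[OF locally_compact_base s openin_topspace, of "inverse (Suc n)"]
    by (metis inverse_positive_iff_positive of_nat_0_less_iff zero_less_Suc)
  then obtain u where u: "\<And>n. u n \<in> Cc"
    "\<And>n x. x \<in> pts \<Longrightarrow> norm_dist (fib B x) (u n x) (s x) \<le> inverse (Suc n)"
    by metis
  have small: "\<exists>N. \<forall>n\<ge>N. inverse (real (Suc n)) < \<epsilon>" if "0 < \<epsilon>" for \<epsilon> :: real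
    using that Archimedean_eventually_inverse[of \<epsilon>] unfolding eventually_sequentially by blast
  have u_dist: "norm_dist A (j (u n)) (j (u m)) \<le> inverse (Suc n) + inverse (Suc m)" for n m
  proof (rule norm_dist_j_le[OF u(1) u(1)])
    fix x assume x: "x \<in> pts"
    interpret F: normed_module "fib B x" using normed_fib[OF x] .
    show "norm_dist (fib B x) (u n x) (u m x) \<le> inverse (Suc n) + inverse (Suc m)"
      using F.metric.triangle[of "u n x" "s x" "u m x"] F.metric.commute[of "s x" "u m x"]
        u(2)[OF x, of n] u(2)[OF x, of m] Cc_in_fib[OF u(1) x] s_fib[OF x] by force
  qed auto
  have "A.metric.MCauchy (\<lambda>n. j (u n))"
    unfolding A.metric.MCauchy_def
  proof (intro conjI allI impI)
    show "range (\<lambda>n. j (u n)) \<subseteq> carrier A"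
      using u(1) by auto
    fix \<epsilon> :: real assume "0 < \<epsilon>"
    then obtain N where N: "\<And>n. N \<le> n \<Longrightarrow> inverse (real (Suc n)) < \<epsilon> / 2"
      using small[of "\<epsilon> / 2"] by auto
    have "norm_dist A (j (u n)) (j (u m)) < \<epsilon>" if "N \<le> n" "N \<le> m" for n m
      using u_dist[of n m] N[OF that(1)] N[OF that(2)] by linarith
    then show "\<exists>N. \<forall>n n'. N \<le> n \<longrightarrow> N \<le> n' \<longrightarrow> norm_dist A (j (u n)) (j (u n')) < \<epsilon>"
      by blast
  qed
  moreover have "A.metric.mcomplete"
    using A.cstar_algebra unfolding cstar_algebra_def banach_space_def by blast
  ultimately obtain a where lim: "limitin A.metric.mtopology (\<lambda>n. j (u n)) a sequentially"
    unfolding A.metric.mcomplete_def by blast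
  then have a: "a \<in> carrier A"
    by (rule A.metric.limitin_mspace)
  have "ev x a = s x" if x: "x \<in> pts" for x
  proof (rule ev_eqI[OF x a s_fib[OF x]])
    fix \<epsilon> :: real assume "0 < \<epsilon>"
    then obtain N where N: "\<And>n. N \<le> n \<Longrightarrow> norm_dist A (j (u n)) a < \<epsilon>"
      using lim unfolding A.metric.limit_metric_sequentially by meson
    obtain N' where N': "\<And>n. N' \<le> n \<Longrightarrow> inverse (real (Suc n)) < \<epsilon>"
      using small[OF \<open>0 < \<epsilon>\<close>] by blast
    have "norm_dist A (j (u (max N N'))) a \<le> \<epsilon>"
      using N[of "max N N'"] by simp
    moreover have "norm_dist (fib B x) (u (max N N') x) (s x) \<le> \<epsilon>"
      using u(2)[OF x, of "max N N'"] N'[of "max N N'"] by linarith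
    ultimately show "\<exists>t\<in>Cc. norm_dist A (j t) a \<le> \<epsilon> \<and> norm_dist (fib B x) (t x) (s x) \<le> \<epsilon>"
      using u(1) by blast
  qed
  moreover have "s \<in> extensional pts"
    using C0_section[OF s] by (simp add: continuous_sections_def)
  ultimately have "sec a = s"
    by (intro extensionalityI[of _ pts]) (auto simp: sec_def)
  with a show ?thesis by blast
qed

theorem star_isomorphic_C0: "star_isomorphic A (C0_algebra B)"
proof -
  have "bij_betw sec (carrier A) (C0_sections B)"
    unfolding bij_betw_def using inj_on_sec sec_in_C0 sec_surj by blast
  then show ?thesis
    unfolding star_isomorphic_def using star_hom_sec C0_algebra_apply(1) by metis
qed

section \<open>Localizability\<close>

text \<open>
  As \<^term>\<open>sec a\<close> is a continuous section, the set where it does not vanish is open, hence equal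
  to its interior.
\<close>

lemma sigma_elem_eq:
  assumes a: "a \<in> carrier A"
  shows "sigma_elem B A j a = {x \<in> pts. ev x a \<noteq> \<zero>\<^bsub>fib B x\<^esub>}"
proof -
  have "{x \<in> pts. eval_at B A j x a \<noteq> \<zero>\<^bsub>fib B x\<^esub>} = {x \<in> pts. sec a x \<noteq> \<zero>\<^bsub>fib B x\<^esub>}"
    using a by (auto simp: eval_at_eq_ev sec_def)
  moreover have "openin (base B) {x \<in> pts. sec a x \<noteq> \<zero>\<^bsub>fib B x\<^esub>}"
    by (rule open_nonzero[OF C0_section[OF sec_in_C0[OF a]]])
  ultimately show ?thesis
    unfolding sigma_elem_def by (auto simp: interior_of_openin sec_def)
qed

lemma submodule_vanishing_off:
  "submodule {a \<in> carrier A. \<forall>x\<in>pts - V. ev x a = \<zero>\<^bsub>fib B x\<^esub>} complex_field A"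
  (is "submodule ?G _ _")
proof (rule A.submoduleI)
  have zero: "z \<odot>\<^bsub>fib B x\<^esub> \<zero>\<^bsub>fib B x\<^esub> = \<zero>\<^bsub>fib B x\<^esub> \<and>
      \<zero>\<^bsub>fib B x\<^esub> \<oplus>\<^bsub>fib B x\<^esub> \<zero>\<^bsub>fib B x\<^esub> = \<zero>\<^bsub>fib B x\<^esub>" if "x \<in> pts" for x z
  proof -
    interpret normed_module "fib B x" using normed_fib[OF that] .
    show ?thesis by simp
  qed
  show "\<zero>\<^bsub>A\<^esub> \<in> ?G"
    using ev_j[OF _ Cc_zero] by (simp add: j_zero conv_apply)
  show smult: "z \<odot>\<^bsub>A\<^esub> a \<in> ?G"
    if "a \<in> ?G" for z a
    using that zero by (simp add: ev_smult)
  show "\<ominus>\<^bsub>A\<^esub> a \<in> ?G"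
    if "a \<in> ?G" for a
    using smult[OF that, of "-1"] that by (simp add: A.smult_minus_one)
  show "a \<oplus>\<^bsub>A\<^esub> b \<in> ?G"
    if "a \<in> ?G"
      "b \<in> ?G" for a b
    using that zero by (simp add: ev_add)
qed auto

text \<open>
  Both sides are the closure of the elements whose evaluations vanish off \<open>V\<close>.  This set \<open>G\<close> is
  already a submodule, so that taking spans adds nothing in \<^const>\<open>gamma\<close>; it contains the images
  of the sections with compact support in \<open>V\<close>, and these are dense in it by cutting off.
\<close>

theorem localizable: "localizable B A j"
  unfolding localizable_def
proof (intro allI impI)
  fix V assume V: "openin (base B) V"
  define G where "G = {a \<in> carrier A. \<forall>x\<in>pts - V. ev x a = \<zero>\<^bsub>fib B x\<^esub>}"
  have G: "{a \<in> carrier A. sigma_elem B A j a \<subseteq> V} = G"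
    unfolding G_def by (auto simp: sigma_elem_eq)
  have gamma: "gamma B A j V = norm_topology A closure_of G"
    unfolding gamma_def closed_span_def G
    using hull_same[of "\<lambda>H. submodule H complex_field A" G] submodule_vanishing_off[of V]
    by (simp add: G_def)
  define P where "P = \<Union>{j ` Cc_sections B U |U. openin (base B) U \<and> U \<subseteq> V}"
  have P: "P = j ` Cc_sections B V"
    unfolding P_def using V Cc_mono by blast
  have Cc_V: "Cc_sections B V \<subseteq> Cc"
    using Cc_mono openin_subset[OF V] .
  have "P \<subseteq> G"
  proof
    fix a assume "a \<in> P"
    then obtain t where t: "t \<in> Cc_sections B V" "a = j t"
      unfolding P by blast
    then have "t x = \<zero>\<^bsub>fib B x\<^esub>" if "x \<in> pts - V" for x
      using that nonzero_in_support[of x t] by (auto simp: Cc_sections_def)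
    then show "a \<in> G"
      using t Cc_V by (auto simp: G_def ev_j)
  qed
  then have "p_star B A j V \<subseteq> gamma B A j V"
    unfolding p_star_def gamma_def closed_span_def G P_def[symmetric]
    by (intro closure_of_mono hull_mono)
  moreover have "G \<subseteq> norm_topology A closure_of P"
  proof
    fix a assume a: "a \<in> G"
    then have aA: "a \<in> carrier A" by (simp add: G_def)
    have "\<exists>b\<in>P. b \<in> carrier A \<and> norm_dist A b a < \<epsilon>" if "0 < \<epsilon>" for \<epsilon>
    proof -
      have vanish: "sec a x = \<zero>\<^bsub>fib B x\<^esub>" if "x \<in> pts" "x \<notin> V" for x
        using that a by (simp add: G_def sec_def)
      obtain t where t: "t \<in> Cc_sections B V"
        "\<And>x. x \<in> pts \<Longrightarrow> norm_dist (fib B x) (t x) (sec a x) \<le> \<epsilon> / 2"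
        using Cc_approximation[OF locally_compact_base sec_in_C0[OF aA] V vanish
            half_gt_zero[OF \<open>0 < \<epsilon>\<close>]] by metis
      have "norm_dist A (j t) a \<le> \<epsilon> / 2"
        using t Cc_V aA that by (intro norm_dist_j_le_ev) (auto simp: sec_def)
      then show ?thesis
        using t(1) Cc_V that P by (intro bexI[of _ "j t"]) auto
    qed
    with aA show "a \<in> norm_topology A closure_of P"
      by (simp add: A.in_norm_closure_iff)
  qed
  then have "gamma B A j V \<subseteq> norm_topology A closure_of P"
    unfolding gamma by (metis closure_of_closure_of closure_of_mono)
  moreover have "norm_topology A closure_of P \<subseteq> p_star B A j V"
    unfolding p_star_def closed_span_def P_def[symmetric] by (intro closure_of_mono hull_subset)
  ultimately show "p_star B A j V = gamma B A j V"
    by blast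
qed

end

theorem theorem4p9:
  fixes B :: "('x, 'e) fibrewise_bundle"
    and A :: "'a normed_star_alg"
    and j :: "('x \<Rightarrow> 'e) \<Rightarrow> 'a"
  assumes "cstar_bundle B"
    and "compatible_completion B A j"
  shows "star_isomorphic A (C0_algebra B) \<and> localizable B A j"
proof -
  interpret compatible_completion_of_bundle B A j
    using assms by unfold_locales (auto simp: cstar_bundle_def)
  show ?thesis
    using star_isomorphic_C0 localizable by blast
qed

end
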